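(* Let $s^1_{\mathcal{D}^1},\dots,s^k_{\mathcal{D}^k}\in\mathcal{S}_T$. The collection $\{J(s^1_{\mathcal{D}^1}),\dots,J(s^k_{\mathcal{D}^k})\}$ of join-irreducibles of $\mathrm{Bic}(T)$ is a face of the canonical join complex $\Delta^{CJ}(\mathrm{Bic}(T))$ if and only if for all distinct $i,j\in\{1,\dots,k\}$: (1) the segments $s^i$ and $s^j$ are distinct; (2) neither $s^i$ nor $s^j$ can be expressed as a composition $t^1\circ\cdots\circ t^r$ with $r\ge 2$ and all $t^q\in J(s^i_{\mathcal{D}^i})\cup J(s^j_{\mathcal{D}^j})$; and (3) neither $J(s^i_{\mathcal{D}^i})\subseteq J(s^j_{\mathcal{D}^j})$ nor $J(s^j_{\mathcal{D}^j})\subseteq J(s^i_{\mathcal{D}^i})$.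
   Context: Let $T$ be a finite tree embedded in a disk so that exactly its leaves lie on the boundary, with every non-leaf vertex of degree at least $3$; the embedding gives a cyclic order of edges at each vertex. A segment is an acyclic path $(v_1,\dots,v_n)$, $n\ge2$, of pairwise distinct consecutive-adjacent vertices such that for each $1\le j\le n-2$ the edge $\{v_{j+1},v_{j+2}\}$ is immediately clockwise or counterclockwise from $\{v_j,v_{j+1}\}$ at $v_{j+1}$; $\mathrm{Seg}(T)$ is the set of segments. For segments $s_1=(v_1,\dots,v_k)$, $s_2=(v_k,\dots,v_n)$ sharing only $v_k$, $s_1\circ s_2=(v_1,\dots,v_n)$; they are composable if this is a segment; an iterated composition $t^1\circ\cdots\circ t^r$ denotes the segment obtained by concatenating the segments $t^1,\dots,t^r$ in order. $B\subseteq\mathrm{Seg}(T)$ is closed if it contains $s_1\circ s_2$ for all composable $s_1,s_2\in B$, biclosed if $B$ and its complement are closed. $\mathrm{Bic}(T)$ is the lattice of biclosed sets under inclusion. A split of a segment $t$ is a proper subsegment of $t$ sharing an endpoint with $t$; a break of $[a,c]$ is a pair $\{[a,b],[b,c]\}$ with $b$ a vertex of $[a,c]$ strictly between $a$ and $c$. $\mathcal{S}_T$ is the set of labels $s_{\mathcal{D}}=(s,\mathcal{D})$ with $s\in\mathrm{Seg}(T)$ having $m$ breaks and $\mathcal{D}$ a set of $m$ splits of $s$ no two in the same break. For $s_{\mathcal{D}}\in\mathcal{S}_T$, $J(s_{\mathcal{D}}):=\{s\}\sqcup\mathcal{D}\sqcup\bigcup_{t\in\mathcal{D}}S(t)$,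 where $S(t)$ is the set of splits $s'$ of $t$ such that $s'$ is not a split of $s$ and $s'$ is not composable with any segment of $\mathcal{D}$; these are exactly the join-irreducible elements of $\mathrm{Bic}(T)$. For a finite lattice $L$: $j\in L$ is join-irreducible if $j\neq\hat0$ and $j=x\vee y$ implies $j\in\{x,y\}$; $\mathrm{JI}(L)$ is the set of these. For $A\subseteq L$, $\bigvee A$ is irredundant if no proper subset $A'\subsetneq A$ has $\bigvee A'=\bigvee A$. For $A,B\subseteq\mathrm{JI}(L)$ with irredundant joins $\bigvee A=\bigvee B$, write $A\preceq B$ if every $a\in A$ is below some $b\in B$. $x=\bigvee A$ with $A\subseteq \mathrm{JI}(L)$ irredundant is a canonical join representation of $x$ if $A\preceq B$ for every irredundant $x=\bigvee B$ with $B\subseteq\mathrm{JI}(L)$. The canonical join complex $\Delta^{CJ}(L)$ is the simplicial complex on vertex set $\mathrm{JI}(L)$ whose faces are the sets $A$ such that $\bigvee A$ is the canonical join representation of some element of $L$. *)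

theory Defs
  imports
    "HOL-Algebra.Lattice"
    "HOL-Combinatorics.Orbits"
    "HOL-Library.Sublist"
begin

section \<open>Trees embedded in a disk\<close>

text \<open>
  An embedding in a disk, with exactly the leaves on the boundary, is recorded by its rotation
  system: \<open>cw T v e\<close> is the edge that comes immediately clockwise after the edge \<open>e\<close> at the
  vertex \<open>v\<close>. For a tree every choice of cyclic orders at the vertices is realised by such an
  embedding, and segments depend on the embedding only through these cyclic orders.
\<close>

record 'v plane_graph =
  vertices :: "'v set"
  edges :: "'v set set"
  cw :: "'v \<Rightarrow> 'v set \<Rightarrow> 'v set"

definition incident_edges :: "'v plane_graph \<Rightarrow> 'v \<Rightarrow> 'v set set" where
  "incident_edges T v = {e \<in> edges T. v \<in> e}"

definition degree :: "'v plane_graph \<Rightarrow> 'v \<Rightarrow> nat" where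
  "degree T v = card (incident_edges T v)"

definition leaf :: "'v plane_graph \<Rightarrow> 'v \<Rightarrow> bool" where
  "leaf T v \<longleftrightarrow> v \<in> vertices T \<and> degree T v = 1"

definition simple_path :: "'v plane_graph \<Rightarrow> 'v list \<Rightarrow> bool" where
  "simple_path T p \<longleftrightarrow> p \<noteq> [] \<and> set p \<subseteq> vertices T \<and> distinct p \<and>
     successively (\<lambda>u v. {u, v} \<in> edges T) p"

definition simple_cycle :: "'v plane_graph \<Rightarrow> 'v list \<Rightarrow> bool" where
  "simple_cycle T p \<longleftrightarrow> simple_path T p \<and> length p \<ge> 3 \<and> {last p, hd p} \<in> edges T"

definition finite_tree :: "'v plane_graph \<Rightarrow> bool" where
  "finite_tree T \<longleftrightarrow>
     finite (vertices T) \<and> vertices T \<noteq> {} \<and>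
     edges T \<subseteq> {{u, v} | u v. u \<in> vertices T \<and> v \<in> vertices T \<and> u \<noteq> v} \<and>
     (\<forall>u \<in> vertices T. \<forall>v \<in> vertices T. \<exists>p. simple_path T p \<and> hd p = u \<and> last p = v) \<and>
     (\<nexists>p. simple_cycle T p)"

definition plane_tree :: "'v plane_graph \<Rightarrow> bool" where
  "plane_tree T \<longleftrightarrow>
     finite_tree T \<and>
     (\<forall>v \<in> vertices T. \<not> leaf T v \<longrightarrow> degree T v \<ge> 3) \<and>
     (\<forall>v \<in> vertices T. cyclic_on (cw T v) (incident_edges T v))"


section \<open>Segments\<close>

definition consecutive_at :: "'v plane_graph \<Rightarrow> 'v \<Rightarrow> 'v set \<Rightarrow> 'v set \<Rightarrow> bool" where
  "consecutive_at T v e e' \<longleftrightarrow> e' = cw T v e \<or> e = cw T v e'"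

definition segment_path :: "'v plane_graph \<Rightarrow> 'v list \<Rightarrow> bool" where
  "segment_path T p \<longleftrightarrow> simple_path T p \<and> length p \<ge> 2 \<and>
     (\<forall>j. j + 2 < length p \<longrightarrow>
        consecutive_at T (p ! (j + 1)) {p ! j, p ! (j + 1)} {p ! (j + 1), p ! (j + 2)})"

text \<open>
  A segment has no orientation: the vertex sequences \<open>p\<close> and \<open>rev p\<close> represent the same segment.
  A segment is therefore the set of its (two) representing sequences.
\<close>

definition unoriented :: "'v list \<Rightarrow> 'v list set" where
  "unoriented p = {p, rev p}"

definition Seg :: "'v plane_graph \<Rightarrow> 'v list set set" where
  "Seg T = {unoriented p | p. segment_path T p}"

definition endpoints :: "'v list set \<Rightarrow> 'v set" where
  "endpoints s = (\<Union>p \<in> s. {hd p, last p})"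

text \<open>
  \<open>is_composition T ts s\<close>: the segments in \<open>ts\<close> can be oriented so that each ends where the next
  begins, and concatenating them in this order (keeping each shared vertex once) gives the segment
  \<open>s\<close>. As \<open>s\<close> has no repeated vertices, the parts meet only at the shared endpoints.
\<close>

definition is_composition ::
    "'v plane_graph \<Rightarrow> 'v list set list \<Rightarrow> 'v list set \<Rightarrow> bool" where
  "is_composition T ts s \<longleftrightarrow> ts \<noteq> [] \<and> set ts \<subseteq> Seg T \<and> s \<in> Seg T \<and>
     (\<exists>ps. ts = map unoriented ps \<and> successively (\<lambda>p q. last p = hd q) ps \<and>
        s = unoriented (hd ps @ concat (map tl (tl ps))))"

definition composable :: "'v plane_graph \<Rightarrow> 'v list set \<Rightarrow> 'v list set \<Rightarrow> bool" where
  "composable T s1 s2 \<longleftrightarrow> (\<exists>s. is_composition T [s1, s2] s)"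

definition closed_segments :: "'v plane_graph \<Rightarrow> 'v list set set \<Rightarrow> bool" where
  "closed_segments T B \<longleftrightarrow> B \<subseteq> Seg T \<and>
     (\<forall>s1 \<in> B. \<forall>s2 \<in> B. \<forall>s. is_composition T [s1, s2] s \<longrightarrow> s \<in> B)"

definition biclosed :: "'v plane_graph \<Rightarrow> 'v list set set \<Rightarrow> bool" where
  "biclosed T B \<longleftrightarrow> closed_segments T B \<and> closed_segments T (Seg T - B)"

definition Bic :: "'v plane_graph \<Rightarrow> 'v list set set gorder" where
  "Bic T = \<lparr>carrier = {B. biclosed T B}, eq = (=), le = (\<subseteq>)\<rparr>"


section \<open>Splits, breaks and labels\<close>

definition subsegment :: "'v plane_graph \<Rightarrow> 'v list set \<Rightarrow> 'v list set \<Rightarrow> bool" where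
  "subsegment T s t \<longleftrightarrow> s \<in> Seg T \<and> t \<in> Seg T \<and> (\<exists>p \<in> s. \<exists>q \<in> t. sublist p q)"

definition splits :: "'v plane_graph \<Rightarrow> 'v list set \<Rightarrow> 'v list set set" where
  "splits T t = {s. subsegment T s t \<and> s \<noteq> t \<and> endpoints s \<inter> endpoints t \<noteq> {}}"

definition breaks :: "'v list set \<Rightarrow> 'v list set set set" where
  "breaks t = {{unoriented (xs @ [b]), unoriented (b # ys)} | xs b ys.
     xs \<noteq> [] \<and> ys \<noteq> [] \<and> xs @ [b] @ ys \<in> t}"

definition labels :: "'v plane_graph \<Rightarrow> ('v list set \<times> 'v list set set) set" where
  "labels T = {(s, D). s \<in> Seg T \<and> D \<subseteq> splits T s \<and> card D = card (breaks s) \<and>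
     (\<forall>b \<in> breaks s. \<forall>x \<in> D. \<forall>y \<in> D. x \<in> b \<and> y \<in> b \<longrightarrow> x = y)}"

definition residual_splits ::
    "'v plane_graph \<Rightarrow> 'v list set \<times> 'v list set set \<Rightarrow> 'v list set \<Rightarrow> 'v list set set" where
  "residual_splits T = (\<lambda>(s, D) t.
     {s' \<in> splits T t. s' \<notin> splits T s \<and> (\<forall>d \<in> D. \<not> composable T s' d)})"

definition J :: "'v plane_graph \<Rightarrow> 'v list set \<times> 'v list set set \<Rightarrow> 'v list set set" where
  "J T = (\<lambda>(s, D). {s} \<union> D \<union> (\<Union>t \<in> D. residual_splits T (s, D) t))"


section \<open>The canonical join complex\<close>

text \<open>
  These notions are meant for finite lattices \<open>L\<close> whose equality \<open>eq L\<close> is \<open>(=)\<close>.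
\<close>

definition JI :: "('a, 'b) gorder_scheme \<Rightarrow> 'a set" where
  "JI L = {j \<in> carrier L. j \<noteq> \<bottom>\<^bsub>L\<^esub> \<and>
     (\<forall>x \<in> carrier L. \<forall>y \<in> carrier L. j = x \<squnion>\<^bsub>L\<^esub> y \<longrightarrow> j \<in> {x, y})}"

definition irredundant_join :: "('a, 'b) gorder_scheme \<Rightarrow> 'a set \<Rightarrow> bool" where
  "irredundant_join L A \<longleftrightarrow> A \<subseteq> carrier L \<and> (\<forall>A'. A' \<subset> A \<longrightarrow> \<Squnion>\<^bsub>L\<^esub>A' \<noteq> \<Squnion>\<^bsub>L\<^esub>A)"

definition join_refines :: "('a, 'b) gorder_scheme \<Rightarrow> 'a set \<Rightarrow> 'a set \<Rightarrow> bool" where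
  "join_refines L A B \<longleftrightarrow> (\<forall>a \<in> A. \<exists>b \<in> B. a \<sqsubseteq>\<^bsub>L\<^esub> b)"

definition canonical_join_representation ::
    "('a, 'b) gorder_scheme \<Rightarrow> 'a \<Rightarrow> 'a set \<Rightarrow> bool" where
  "canonical_join_representation L x A \<longleftrightarrow>
     A \<subseteq> JI L \<and> irredundant_join L A \<and> x = \<Squnion>\<^bsub>L\<^esub>A \<and>
     (\<forall>B. B \<subseteq> JI L \<and> irredundant_join L B \<and> x = \<Squnion>\<^bsub>L\<^esub>B \<longrightarrow> join_refines L A B)"

text \<open>The complex is given by its set of faces; the empty face is included.\<close>

definition canonical_join_complex :: "('a, 'b) gorder_scheme \<Rightarrow> 'a set set" where
  "canonical_join_complex L = {A. \<exists>x \<in> carrier L. canonical_join_representation L x A}"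

end

theory Submission
  imports Defs
begin

text \<open>
  Joins in the lattice of biclosed sets are closures of unions under composition, and every covering
  relation removes a single segment. For a biclosed set \<open>x\<close> and a segment \<open>s \<in> x\<close> such that
  \<open>x - {s}\<close> is biclosed, \<open>x\<close> contains exactly one split of \<open>s\<close> from each break; if \<open>D\<close> is the set of these
  splits, then \<open>J(s, D)\<close> is the least biclosed subset of \<open>x\<close> containing \<open>s\<close>. Hence \<open>J(s\<^sub>i, D\<^sub>i)\<close> are the
  canonical joinands of their join \<open>x\<close> exactly if they form an antichain and every \<open>x - {s\<^sub>i}\<close> is biclosed.

  That the pairwise conditions suffice for the latter rests on one observation. Orient \<open>s\<^sub>i\<close> and suppose it is a
  composition of several segments of the union. Call a joint low if the initial piece of \<open>s\<^sub>i\<close> up to it is in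
  \<open>D\<^sub>i\<close>, and high if the final piece is. Some part runs from a low joint or the start to a high joint or the
  end. Already \<open>s\<^sub>i\<close> is the composition of the initial piece, this single part and the final piece, and
  these come from at most two of the \<open>J(s\<^sub>j, D\<^sub>j)\<close>.
\<close>

section \<open>Segments and biclosed sets\<close>

lemma unoriented_rev [simp]: "unoriented (rev p) = unoriented p"
  by (auto simp: unoriented_def)

lemma unoriented_eq_iff: "unoriented p = unoriented q \<longleftrightarrow> p = q \<or> p = rev q"
  by (auto simp: unoriented_def doubleton_eq_iff)

lemma unoriented_eq_set: "unoriented p = unoriented q \<Longrightarrow> set p = set q"
  by (auto simp: unoriented_eq_iff)

lemma unoriented_eq_length: "unoriented p = unoriented q \<Longrightarrow> length p = length q"
  by (auto simp: unoriented_eq_iff)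

lemma endpoints_unoriented [simp]: "endpoints (unoriented p) = {hd p, last p}"
  by (auto simp: endpoints_def unoriented_def hd_rev last_rev)

lemma segment_path_distinct: "segment_path T p \<Longrightarrow> distinct p"
  by (auto simp: segment_path_def simple_path_def)

lemma segment_path_length: "segment_path T p \<Longrightarrow> 2 \<le> length p"
  by (auto simp: segment_path_def)

lemma segment_path_rev:
  assumes "segment_path T p"
  shows "segment_path T (rev p)"
proof -
  have "consecutive_at T (rev p ! (j + 1)) {rev p ! j, rev p ! (j + 1)} {rev p ! (j + 1), rev p ! (j + 2)}"
    if j: "j + 2 < length p" for j
  proof -
    \<comment> \<open>The entries of \<open>rev p\<close> at \<open>j\<close>, \<open>j + 1\<close>,
      \<open>j + 2\<close> are those of \<open>p\<close> at \<open>i + 2\<close>,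
      \<open>i + 1\<close>, \<open>i\<close>, and the condition at the middle vertex is symmetric in
      the two edges.\<close>
    define i where "i = length p - (j + 3)"
    have i: "i + 2 < length p" "rev p ! j = p ! (i + 2)" "rev p ! (j + 1) = p ! (i + 1)"
      "rev p ! (j + 2) = p ! i"
      using j by (auto simp: i_def rev_nth intro!: arg_cong[of _ _ "nth p"])
    have "consecutive_at T (p ! (i + 1)) {p ! i, p ! (i + 1)} {p ! (i + 1), p ! (i + 2)}"
      using assms i(1) by (auto simp: segment_path_def)
    then show ?thesis
      unfolding i consecutive_at_def by (auto simp: insert_commute)
  qed
  then show ?thesis
    using assms by (auto simp: segment_path_def simple_path_def insert_commute)
qed

lemma segment_path_rev_iff [simp]: "segment_path T (rev p) \<longleftrightarrow> segment_path T p"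
  using segment_path_rev[of T p] segment_path_rev[of T "rev p"] by auto

lemma segment_path_infix:
  assumes p: "segment_path T (xs @ q @ ys)" and q: "2 \<le> length q"
  shows "segment_path T q"
proof -
  have "consecutive_at T (q ! (j + 1)) {q ! j, q ! (j + 1)} {q ! (j + 1), q ! (j + 2)}"
    if j: "j + 2 < length q" for j
  proof -
    have nth: "(xs @ q @ ys) ! (length xs + i) = q ! i" if "i < length q" for i
      using that by (simp add: nth_append)
    have "(length xs + j) + 2 < length (xs @ q @ ys)"
      using j by simp
    then have "consecutive_at T ((xs @ q @ ys) ! (length xs + j + 1))
        {(xs @ q @ ys) ! (length xs + j), (xs @ q @ ys) ! (length xs + j + 1)}
        {(xs @ q @ ys) ! (length xs + j + 1), (xs @ q @ ys) ! (length xs + j + 2)}"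
      using p unfolding segment_path_def by blast
    then show ?thesis
      unfolding add.assoc using j by (subst (asm) (1 2 3 4 5) nth) auto
  qed
  then show ?thesis
    using p q by (auto simp: segment_path_def simple_path_def successively_append_iff)
qed

lemma segment_path_pieces:
  assumes "segment_path T (xs @ b # ys)"
  shows "xs \<noteq> [] \<Longrightarrow> segment_path T (xs @ [b])" "ys \<noteq> [] \<Longrightarrow> segment_path T (b # ys)"
  using assms segment_path_infix[of T "[]" "xs @ [b]" ys] segment_path_infix[of T xs "b # ys" "[]"]
  by (cases xs; cases ys; auto)+

lemma unoriented_in_Seg [simp]: "unoriented p \<in> Seg T \<longleftrightarrow> segment_path T p"
  by (auto simp: Seg_def unoriented_eq_iff)

lemma Seg_cases:
  assumes "s \<in> Seg T"
  obtains p where "s = unoriented p" "segment_path T p"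
  using assms by (auto simp: Seg_def)

lemma finite_Seg:
  assumes "plane_tree T"
  shows "finite (Seg T)"
proof -
  have "Seg T \<subseteq> unoriented ` {p. set p \<subseteq> vertices T \<and> distinct p}"
    by (auto simp: Seg_def segment_path_def simple_path_def)
  moreover have "finite {p. set p \<subseteq> vertices T \<and> distinct p}"
    using assms by (intro finite_subset_distinct) (auto simp: plane_tree_def finite_tree_def)
  ultimately show ?thesis
    using finite_surj by blast
qed

text \<open>The two pieces share only the vertex \<open>b\<close>, and at least one of them has a
  further vertex.\<close>

lemma breaks_ends_neq:
  assumes "distinct (xs @ b # ys)" "xs \<noteq> [] \<or> ys \<noteq> []"
  shows "unoriented (xs @ [b]) \<noteq> unoriented (b # ys)"
proof
  assume "unoriented (xs @ [b]) = unoriented (b # ys)"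
  then have "set (xs @ [b]) = set (b # ys)"
    by (rule unoriented_eq_set)
  then show False
    using assms by (cases xs; cases ys) auto
qed

section \<open>Compositions, closed and biclosed sets\<close>

lemma is_composition_two_iff:
  "is_composition T [s1, s2] s \<longleftrightarrow> (\<exists>xs b ys. xs \<noteq> [] \<and> ys \<noteq> [] \<and> segment_path T (xs @ b # ys) \<and>
     s1 = unoriented (xs @ [b]) \<and> s2 = unoriented (b # ys) \<and> s = unoriented (xs @ b # ys))"
  (is "?L \<longleftrightarrow> ?R")
proof
  assume ?L
  then obtain p q where *: "s1 = unoriented p" "s2 = unoriented q" "last p = hd q"
      "s = unoriented (p @ tl q)" "segment_path T p" "segment_path T q" "segment_path T (p @ tl q)"
    by (auto simp: is_composition_def map_eq_Cons_conv Cons_eq_map_conv)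
  obtain xs b where p: "p = xs @ [b]"
    using *(5) by (cases p rule: rev_cases) (auto dest: segment_path_length)
  obtain b' ys where q: "q = b' # ys"
    using *(6) by (cases q) (auto dest: segment_path_length)
  have "xs \<noteq> []" "ys \<noteq> []"
    using *(5,6) p q by (auto dest: segment_path_length)
  then show ?R
    using * p q by auto
next
  assume ?R
  then obtain xs b ys where *: "xs \<noteq> []" "ys \<noteq> []" "segment_path T (xs @ b # ys)"
      "s1 = unoriented (xs @ [b])" "s2 = unoriented (b # ys)" "s = unoriented (xs @ b # ys)"
    by blast
  then show ?L
    unfolding is_composition_def
    by (auto simp: segment_path_pieces intro!: exI[of _ "[xs @ [b], b # ys]"])
qed

lemma is_composition_two:
  assumes "segment_path T (xs @ b # ys)" "xs \<noteq> []" "ys \<noteq> []"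
  shows "is_composition T [unoriented (xs @ [b]), unoriented (b # ys)] (unoriented (xs @ b # ys))"
  using assms unfolding is_composition_two_iff by blast

lemma is_composition_three:
  assumes "segment_path T (xs @ b # ms @ c # ys)" "xs \<noteq> []" "ys \<noteq> []"
  shows "is_composition T [unoriented (xs @ [b]), unoriented (b # ms @ [c]), unoriented (c # ys)]
     (unoriented (xs @ b # ms @ c # ys))"
proof -
  have "segment_path T (xs @ [b])" "segment_path T (b # ms @ c # ys)"
    using assms segment_path_pieces[of T xs b] by auto
  moreover from this(2) have "segment_path T (b # ms @ [c])" "segment_path T (c # ys)"
    using assms segment_path_pieces[of T "b # ms" c ys] by auto
  ultimately show ?thesis
    unfolding is_composition_def using assms
    by (auto intro!: exI[of _ "[xs @ [b], b # ms @ [c], c # ys]"])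
qed

lemma closed_segments_iff:
  "closed_segments T B \<longleftrightarrow> B \<subseteq> Seg T \<and>
     (\<forall>xs b ys. xs \<noteq> [] \<longrightarrow> ys \<noteq> [] \<longrightarrow> segment_path T (xs @ b # ys) \<longrightarrow> unoriented (xs @ [b]) \<in> B \<longrightarrow>
        unoriented (b # ys) \<in> B \<longrightarrow> unoriented (xs @ b # ys) \<in> B)"
  unfolding closed_segments_def is_composition_two_iff by blast

text \<open>The second implication is closedness of the complement, read contrapositively: a
  biclosed set meets every break of each of its members.\<close>

lemma biclosed_iff:
  "biclosed T B \<longleftrightarrow> B \<subseteq> Seg T \<and>
     (\<forall>xs b ys. xs \<noteq> [] \<longrightarrow> ys \<noteq> [] \<longrightarrow> segment_path T (xs @ b # ys) \<longrightarrow>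
       (unoriented (xs @ [b]) \<in> B \<longrightarrow> unoriented (b # ys) \<in> B \<longrightarrow> unoriented (xs @ b # ys) \<in> B) \<and>
       (unoriented (xs @ b # ys) \<in> B \<longrightarrow> unoriented (xs @ [b]) \<in> B \<or> unoriented (b # ys) \<in> B))"
  unfolding biclosed_def closed_segments_iff by (simp add: segment_path_pieces) blast

lemma biclosed_subset: "biclosed T B \<Longrightarrow> B \<subseteq> Seg T"
  by (simp add: biclosed_iff)

lemma biclosed_join:
  "\<lbrakk>biclosed T B; xs \<noteq> []; ys \<noteq> []; segment_path T (xs @ b # ys); unoriented (xs @ [b]) \<in> B;
    unoriented (b # ys) \<in> B\<rbrakk> \<Longrightarrow> unoriented (xs @ b # ys) \<in> B"
  by (simp add: biclosed_iff)

lemma biclosed_break: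
  assumes "biclosed T B" "unoriented (xs @ b # ys) \<in> B" "xs \<noteq> []" "ys \<noteq> []"
  shows "unoriented (xs @ [b]) \<in> B \<or> unoriented (b # ys) \<in> B"
proof -
  have "segment_path T (xs @ b # ys)"
    using assms biclosed_subset unoriented_in_Seg by blast
  then show ?thesis
    using assms unfolding biclosed_iff by blast
qed

lemma biclosed_complement: "biclosed T B \<Longrightarrow> biclosed T (Seg T - B)"
  by (simp add: biclosed_def closed_segments_iff double_diff)

text \<open>All parts but the first compose to a final piece of the path, which is again a segment;
  so induction reduces the claim to closedness under two parts.\<close>

lemma is_composition_closed:
  assumes C: "closed_segments T C" and "successively (\<lambda>p q. last p = hd q) ps" "ps \<noteq> []"
    and "unoriented ` set ps \<subseteq> C" "segment_path T (hd ps @ concat (map tl (tl ps)))"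
  shows "unoriented (hd ps @ concat (map tl (tl ps))) \<in> C"
  using assms(2-)
proof (induction ps)
  case (Cons p ps)
  show ?case
  proof (cases ps)
    case (Cons q qs)
    have "segment_path T p" "segment_path T q"
      using Cons.prems Cons C unoriented_in_Seg closed_segments_iff by (metis (no_types, lifting) image_subset_iff list.set_intros subset_iff)+
    then obtain xs b c ys where p: "p = xs @ [b]" "xs \<noteq> []" and "q = c # ys" "ys \<noteq> []"
      using segment_path_length[of T p] segment_path_length[of T q]
      by (cases p rule: rev_cases; cases q) fastforce+
    then have q: "q = b # ys" "ys \<noteq> []"
      using Cons.prems(1) Cons by auto
    have big: "segment_path T (xs @ b # ys @ concat (map tl qs))"
      using Cons.prems(4) by (simp add: Cons p q)
    have "unoriented (b # ys @ concat (map tl qs)) \<in> C"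
      using Cons.IH Cons.prems segment_path_pieces(2)[OF big] by (simp add: Cons q)
    moreover have "unoriented (xs @ [b]) \<in> C"
      using Cons.prems by (simp add: p)
    ultimately have "unoriented (xs @ b # ys @ concat (map tl qs)) \<in> C"
      using C big p q unfolding closed_segments_iff by blast
    then show ?thesis
      by (simp add: Cons p q)
  qed (use Cons in auto)
qed auto

section \<open>The join-irreducibles as sets of pieces\<close>

lemma snoc_of_length_ge_2:
  assumes "2 \<le> length q"
  obtains as b where "q = as @ [b]" "as \<noteq> []"
  using assms by (cases q rule: rev_cases) fastforce+

lemma Cons_of_length_ge_2:
  assumes "2 \<le> length q"
  obtains b as where "q = b # as" "as \<noteq> []"
  using assms by (cases q) fastforce+

lemma distinct_split_unique:
  assumes "distinct (xs @ b # ys)" "xs @ b # ys = xs' @ b # ys'"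
  shows "xs = xs'" "ys = ys'"
proof -
  have "b \<notin> set xs" "b \<notin> set ys"
    using assms(1) by auto
  then show "xs = xs'" "ys = ys'"
    using assms(2) append_Cons_eq_iff[of b xs ys xs' ys'] by auto
qed

lemma self_in_unoriented [simp]: "p \<in> unoriented p"
  by (simp add: unoriented_def)

text \<open>The vertices of \<open>p\<close> are distinct, so a subpath sharing an endpoint with
  \<open>p\<close> reaches one end of \<open>p\<close> and is an initial or a final piece.\<close>

lemma splits_unoriented:
  assumes p: "segment_path T p"
  shows "splits T (unoriented p) =
    {unoriented (xs @ [b]) | xs b ys. p = xs @ b # ys \<and> xs \<noteq> [] \<and> ys \<noteq> []} \<union>
    {unoriented (b # ys) | xs b ys. p = xs @ b # ys \<and> xs \<noteq> [] \<and> ys \<noteq> []}" (is "_ = ?R")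
proof (intro equalityI subsetI)
  fix s assume "s \<in> splits T (unoriented p)"
  then obtain r q where s: "s \<in> Seg T" "s \<noteq> unoriented p" "endpoints s \<inter> endpoints (unoriented p) \<noteq> {}"
     "r \<in> s" "q = p \<or> q = rev p" "sublist r q"
    by (auto simp: splits_def subsegment_def unoriented_def)
  obtain r' where r': "s = unoriented r'" "sublist r' p"
  proof -
    have "s = unoriented r"
      using s(1,4) by (auto simp: Seg_def unoriented_def)
    then show ?thesis
      using that[of r] that[of "rev r"] s(5,6) by (auto simp: sublist_rev_left)
  qed
  then obtain xs ys where pp: "p = xs @ r' @ ys"
    by (auto simp: sublist_def)
  have r2: "2 \<le> length r'"
    using s(1) r' by (auto dest: segment_path_length)
  have d: "distinct (xs @ r' @ ys)"
    using p pp segment_path_distinct by blast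
  have "{hd r', last r'} \<inter> {hd p, last p} \<noteq> {}"
    using s(3) r' by auto
  moreover have "r' \<noteq> []"
    using r2 by auto
  then have "hd r' \<in> set r'" "last r' \<in> set r'"
    by auto
  ultimately have "xs = [] \<or> ys = []"
    using d r2 unfolding pp by (cases xs; cases ys rule: rev_cases) auto
  then show "s \<in> ?R"
  proof
    assume xs: "xs = []"
    then have ys: "ys \<noteq> []"
      using s(2) r' pp by auto
    obtain as b where "r' = as @ [b]" "as \<noteq> []"
      using r2 snoc_of_length_ge_2 by blast
    then show ?thesis
      using xs ys pp r' by fastforce
  next
    assume ys: "ys = []"
    then have xs: "xs \<noteq> []"
      using s(2) r' pp by auto
    obtain as b where "r' = b # as" "as \<noteq> []"
      using r2 Cons_of_length_ge_2 by blast
    then show ?thesis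
      using xs ys pp r' by fastforce
  qed
next
  fix s assume "s \<in> ?R"
  then obtain xs b ys where pp: "p = xs @ b # ys" "xs \<noteq> []" "ys \<noteq> []"
      and s: "s = unoriented (xs @ [b]) \<or> s = unoriented (b # ys)"
    by auto
  have seg: "segment_path T (xs @ [b])" "segment_path T (b # ys)"
    using p segment_path_pieces pp by auto
  have neq: "unoriented (xs @ [b]) \<noteq> unoriented p" "unoriented (b # ys) \<noteq> unoriented p"
    using pp by (auto dest: unoriented_eq_length)
  have "endpoints (unoriented (xs @ [b])) \<inter> endpoints (unoriented p) \<noteq> {}"
    "endpoints (unoriented (b # ys)) \<inter> endpoints (unoriented p) \<noteq> {}"
    using pp by auto
  moreover have "subsegment T (unoriented (xs @ [b])) (unoriented p)"
    "subsegment T (unoriented (b # ys)) (unoriented p)"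
  proof -
    have "sublist (xs @ [b]) p" "sublist (b # ys) p"
      using sublist_appendI[of "xs @ [b]" "[]" ys] pp by auto
    then show "subsegment T (unoriented (xs @ [b])) (unoriented p)"
      "subsegment T (unoriented (b # ys)) (unoriented p)"
      unfolding subsegment_def using p seg by (meson self_in_unoriented unoriented_in_Seg)+
  qed
  ultimately show "s \<in> splits T (unoriented p)"
    using s neq by (auto simp: splits_def)
qed

text \<open>\<open>breaks\<close> ranges over both orientations, but reversing the path only
  interchanges the two pieces at \<open>b\<close>; one fixed orientation therefore suffices.\<close>

lemma in_breaks_iff:
  "e \<in> breaks (unoriented p) \<longleftrightarrow> (\<exists>xs b ys. p = xs @ b # ys \<and> xs \<noteq> [] \<and> ys \<noteq> [] \<and>
     e = {unoriented (xs @ [b]), unoriented (b # ys)})" (is "?L \<longleftrightarrow> ?R")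
proof
  assume ?L
  then obtain xs b ys where *: "xs @ b # ys = p \<or> xs @ b # ys = rev p" "xs \<noteq> []" "ys \<noteq> []"
      "e = {unoriented (xs @ [b]), unoriented (b # ys)}"
    by (auto simp: breaks_def unoriented_def[of p])
  from *(1) show ?R
  proof
    assume "xs @ b # ys = rev p"
    then have "p = rev ys @ b # rev xs"
      by (metis append.assoc append_Cons append_Nil rev.simps(2) rev_append rev_rev_ident)
    moreover have "e = {unoriented (rev ys @ [b]), unoriented (b # rev xs)}"
      using *(4) unoriented_rev[of "b # ys"] unoriented_rev[of "xs @ [b]"]
      by (auto simp del: unoriented_rev)
    ultimately show ?R
      using * by blast
  qed (use * in blast)
next
  assume ?R
  then obtain xs b ys where "xs @ [b] @ ys = p" "xs \<noteq> []" "ys \<noteq> []"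
      "e = {unoriented (xs @ [b]), unoriented (b # ys)}"
    by auto
  then show ?L
    unfolding breaks_def using self_in_unoriented[of p] by blast
qed

text \<open>Unlike \<open>labels\<close>, this involves no cardinalities, which makes it easier to establish.\<close>

definition split_choice :: "'v plane_graph \<Rightarrow> 'v list \<Rightarrow> 'v list set set \<Rightarrow> bool" where
  "split_choice T p D \<longleftrightarrow> segment_path T p \<and> D \<subseteq> splits T (unoriented p) \<and>
     (\<forall>xs b ys. p = xs @ b # ys \<longrightarrow> xs \<noteq> [] \<longrightarrow> ys \<noteq> [] \<longrightarrow>
        (unoriented (xs @ [b]) \<in> D \<longleftrightarrow> unoriented (b # ys) \<notin> D))"

lemma split_choice_path: "split_choice T p D \<Longrightarrow> segment_path T p"
  by (simp add: split_choice_def)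

lemma split_choice_break:
  "\<lbrakk>split_choice T p D; p = xs @ b # ys; xs \<noteq> []; ys \<noteq> []\<rbrakk> \<Longrightarrow>
     unoriented (xs @ [b]) \<in> D \<longleftrightarrow> unoriented (b # ys) \<notin> D"
  unfolding split_choice_def by blast

lemma split_choice_cases:
  assumes "split_choice T p D" "d \<in> D"
  obtains xs b ys where "p = xs @ b # ys" "xs \<noteq> []" "ys \<noteq> []" "d = unoriented (xs @ [b])"
  | xs b ys where "p = xs @ b # ys" "xs \<noteq> []" "ys \<noteq> []" "d = unoriented (b # ys)"
proof -
  have "d \<in> splits T (unoriented p)" "segment_path T p"
    using assms unfolding split_choice_def by blast+
  then show ?thesis
    using that by (auto simp: splits_unoriented)
qed

lemma split_choice_rev:
  assumes "split_choice T p D"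
  shows "split_choice T (rev p) D"
  unfolding split_choice_def
proof (intro conjI allI impI)
  fix xs b ys assume *: "rev p = xs @ b # ys" "xs \<noteq> []" "ys \<noteq> []"
  then have "p = rev ys @ b # rev xs"
    by (metis append.assoc append_Cons append_Nil rev.simps(2) rev_append rev_rev_ident)
  then have "unoriented (rev ys @ [b]) \<in> D \<longleftrightarrow> unoriented (b # rev xs) \<notin> D"
    using split_choice_break[OF assms] * by blast
  then show "unoriented (xs @ [b]) \<in> D \<longleftrightarrow> unoriented (b # ys) \<notin> D"
    using unoriented_rev[of "b # ys"] unoriented_rev[of "xs @ [b]"]
    by (auto simp del: unoriented_rev)
qed (use assms in \<open>auto simp: split_choice_def\<close>)

text \<open>Sending each member of \<open>D\<close> to a break that contains it is injective, since
  no break contains two members. The set of breaks is finite and has as many elements as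
  \<open>D\<close>, so every break is hit.\<close>

lemma labels_split_choice:
  assumes "plane_tree T" "(unoriented p, D) \<in> labels T"
  shows "split_choice T p D"
proof -
  have *: "unoriented p \<in> Seg T \<and> D \<subseteq> splits T (unoriented p) \<and> card D = card (breaks (unoriented p)) \<and>
      (\<forall>e \<in> breaks (unoriented p). \<forall>x \<in> D. \<forall>y \<in> D. x \<in> e \<and> y \<in> e \<longrightarrow> x = y)"
    using assms(2) unfolding labels_def mem_Collect_eq case_prod_conv .
  then have p: "segment_path T p" and D: "D \<subseteq> splits T (unoriented p)"
    and card: "card D = card (breaks (unoriented p))"
    unfolding unoriented_in_Seg by blast+
  have inj: "x = y" if "e \<in> breaks (unoriented p)" "x \<in> D" "y \<in> D" "x \<in> e" "y \<in> e" for e x y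
    using * that by blast
  have "\<exists>e \<in> breaks (unoriented p). d \<in> e" if "d \<in> D" for d
  proof -
    have "d \<in> splits T (unoriented p)"
      using that D by blast
    then obtain xs b ys where *: "p = xs @ b # ys" "xs \<noteq> []" "ys \<noteq> []"
        and d: "d \<in> {unoriented (xs @ [b]), unoriented (b # ys)}"
      by (auto simp: splits_unoriented[OF p])
    then have "{unoriented (xs @ [b]), unoriented (b # ys)} \<in> breaks (unoriented p)"
      unfolding in_breaks_iff by blast
    then show ?thesis
      using d by (rule bexI[rotated])
  qed
  then have "\<forall>d \<in> D. \<exists>e. e \<in> breaks (unoriented p) \<and> d \<in> e"
    by blast
  from bchoice[OF this] obtain f where f: "\<And>d. d \<in> D \<Longrightarrow> f d \<in> breaks (unoriented p)" "\<And>d. d \<in> D \<Longrightarrow> d \<in> f d"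
    by blast
  have "splits T (unoriented p) \<subseteq> Seg T"
    by (auto simp: splits_def subsegment_def)
  then have seg: "e \<subseteq> Seg T" if "e \<in> breaks (unoriented p)" for e
    using that p by (auto simp: in_breaks_iff segment_path_pieces)
  then have "finite (breaks (unoriented p))"
    using finite_Seg[OF assms(1)] by (meson PowI finite_Pow_iff finite_subset subsetI)
  moreover have "inj_on f D"
    using f inj[OF f(1)] by (intro inj_onI) metis
  moreover have "f ` D \<subseteq> breaks (unoriented p)"
    using f(1) by blast
  ultimately have surj: "f ` D = breaks (unoriented p)"
    by (simp add: card card_image card_subset_eq)
  show ?thesis
    unfolding split_choice_def
  proof (intro conjI allI impI)
    fix xs b ys assume *: "p = xs @ b # ys" "xs \<noteq> []" "ys \<noteq> []"
    define e where "e = {unoriented (xs @ [b]), unoriented (b # ys)}"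
    have e: "e \<in> breaks (unoriented p)"
      using * by (auto simp: in_breaks_iff e_def)
    then obtain d where "d \<in> D" "d \<in> e"
      using surj f(2) by blast
    moreover have "unoriented (xs @ [b]) \<noteq> unoriented (b # ys)"
      using breaks_ends_neq[of xs b ys] * segment_path_distinct[OF p] by simp
    ultimately show "unoriented (xs @ [b]) \<in> D \<longleftrightarrow> unoriented (b # ys) \<notin> D"
      using inj[OF e, of "unoriented (xs @ [b])" "unoriented (b # ys)"] by (auto simp: e_def)
  qed (use p D in auto)
qed

section \<open>The pieces that make up \<open>J\<close>\<close>

text \<open>A necessary condition that serves to refute composability.\<close>

lemma composable_ends:
  assumes "composable T (unoriented p) (unoriented q)"
  shows "(\<exists>v. set p \<inter> set q = {v} \<and> v \<in> {hd p, last p} \<and> v \<in> {hd q, last q})"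
proof -
  obtain xs b ys where *: "segment_path T (xs @ b # ys)"
      "unoriented p = unoriented (xs @ [b])" "unoriented q = unoriented (b # ys)"
    using assms by (auto simp: composable_def is_composition_two_iff)
  have "set p \<inter> set q = {b}"
    using *(2,3)[THEN unoriented_eq_set] segment_path_distinct[OF *(1)] by auto
  moreover have "b \<in> {hd p, last p}" "b \<in> {hd q, last q}"
    using *(2,3) by (auto simp: unoriented_eq_iff hd_append hd_rev last_rev)
  ultimately show ?thesis
    by blast
qed

text \<open>
  Walk along \<open>p\<close>. The vertices strictly inside \<open>p\<close> fall into those whose initial piece is in \<open>D\<close> and
  those whose final piece is in \<open>D\<close>; \<open>J\<close> consists of the pieces of \<open>p\<close> that start at the start of
  \<open>p\<close> or at a vertex of the second kind and stop at the end of \<open>p\<close> or at a vertex of the first kind.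
\<close>

definition J_pieces :: "'v list \<Rightarrow> 'v list set set \<Rightarrow> 'v list set set" where
  "J_pieces p D = {unoriented q | xs q ys. p = xs @ q @ ys \<and> 2 \<le> length q \<and>
     (xs \<noteq> [] \<longrightarrow> unoriented (q @ ys) \<in> D) \<and> (ys \<noteq> [] \<longrightarrow> unoriented (xs @ q) \<in> D)}"

lemma J_piecesI:
  assumes "p = xs @ q @ ys" "2 \<le> length q"
    "xs \<noteq> [] \<Longrightarrow> unoriented (q @ ys) \<in> D" "ys \<noteq> [] \<Longrightarrow> unoriented (xs @ q) \<in> D"
  shows "unoriented q \<in> J_pieces p D"
  using assms unfolding J_pieces_def by blast

lemma J_pieces_rev [simp]: "J_pieces (rev p) D = J_pieces p D"
proof -
  have *: "J_pieces p D \<subseteq> J_pieces (rev p) D" for p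
  proof
    fix s assume "s \<in> J_pieces p D"
    then obtain xs q ys where "s = unoriented q" "p = xs @ q @ ys" "2 \<le> length q"
      "xs \<noteq> [] \<longrightarrow> unoriented (q @ ys) \<in> D" "ys \<noteq> [] \<longrightarrow> unoriented (xs @ q) \<in> D"
      unfolding J_pieces_def by blast
    then show "s \<in> J_pieces (rev p) D"
      using J_piecesI[of "rev p" "rev ys" "rev q" "rev xs" D] unoriented_rev[of "q @ ys"] unoriented_rev[of "xs @ q"]
      by (simp del: unoriented_rev add: unoriented_rev[of q])
  qed
  show ?thesis
    using *[of p] *[of "rev p"] by auto
qed

text \<open>A residual split of an initial piece must be a final part of it, because the initial
  parts are splits of \<open>p\<close>. It composes with \<open>xs @ [c]\<close>, which is therefore
  not in \<open>D\<close>; so the opposite split at \<open>c\<close> is in \<open>D\<close>, as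
  \<open>J_pieces\<close> demands.\<close>

lemma residual_splits_subset_J_pieces:
  assumes p: "split_choice T p D" "p = as @ b # bs" "as \<noteq> []" "bs \<noteq> []" "unoriented (as @ [b]) \<in> D"
  shows "residual_splits T (unoriented p, D) (unoriented (as @ [b])) \<subseteq> J_pieces p D"
proof
  fix s assume s: "s \<in> residual_splits T (unoriented p, D) (unoriented (as @ [b]))"
  have seg: "segment_path T p" "segment_path T (as @ [b])"
    using split_choice_path[OF p(1)] segment_path_pieces(1)[of T as b bs] p by auto
  from s have "s \<in> splits T (unoriented (as @ [b]))" "s \<notin> splits T (unoriented p)"
    and ncomp: "\<And>d. d \<in> D \<Longrightarrow> \<not> composable T s d"
    by (auto simp: residual_splits_def)
  then obtain xs c ys where *: "as @ [b] = xs @ c # ys" "xs \<noteq> []" "ys \<noteq> []"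
      and "s = unoriented (xs @ [c]) \<or> s = unoriented (c # ys)"
    by (auto simp: splits_unoriented[OF seg(2)])
  have pc: "p = xs @ c # (ys @ bs)"
    using p(2) arg_cong[OF *(1), of "\<lambda>z. z @ bs"] by simp
  have "unoriented (xs @ [c]) \<in> splits T (unoriented p)"
    using pc * unfolding splits_unoriented[OF seg(1)] by blast
  with \<open>s \<notin> _\<close> \<open>s = _ \<or> _\<close> have s: "s = unoriented (c # ys)"
    by auto
  have "composable T (unoriented (c # ys)) (unoriented (xs @ [c]))"
  proof -
    have "composable T (unoriented (rev ys @ [c])) (unoriented (c # rev xs))"
      unfolding composable_def is_composition_two_iff
      using * seg(2) segment_path_rev[OF seg(2)]
      by (intro exI[of _ "unoriented (rev ys @ c # rev xs)"] exI[of _ "rev ys"] exI[of _ c] exI[of _ "rev xs"]) auto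
    then show ?thesis
      using unoriented_rev[of "c # ys"] unoriented_rev[of "xs @ [c]"] by (simp del: unoriented_rev)
  qed
  then have "unoriented (xs @ [c]) \<notin> D"
    using ncomp s by blast
  then have "unoriented (c # ys @ bs) \<in> D"
    using split_choice_break[OF p(1) pc] * by blast
  then show "s \<in> J_pieces p D"
    using J_piecesI[of p xs "c # ys" bs D] pc *(1,3) p(5) s by (simp add: Suc_le_eq)
qed

text \<open>A common endpoint cannot be the start of \<open>p\<close>, which lies in
  \<open>xs\<close>, so it is \<open>b\<close>. If \<open>q\<close> starts at \<open>b\<close>, then
  \<open>D\<close> contains both pieces of the break at \<open>b\<close>; if \<open>q\<close> ends
  at \<open>b\<close>, then all of \<open>q\<close> lies in the initial piece and more than one
  vertex is shared.\<close>

lemma middle_not_composable_prefix: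
  assumes *: "split_choice T p D" "p = xs @ q @ ys" "2 \<le> length q" "xs \<noteq> []" "ys \<noteq> []" "unoriented (q @ ys) \<in> D"
    "p = as @ b # bs" "as \<noteq> []" "bs \<noteq> []" "unoriented (as @ [b]) \<in> D"
  shows "\<not> composable T (unoriented q) (unoriented (as @ [b]))"
proof
  assume "composable T (unoriented q) (unoriented (as @ [b]))"
  then obtain v where v: "set q \<inter> set (as @ [b]) = {v}" "v = hd q \<or> v = last q" "v = hd as \<or> v = b"
    using composable_ends[of T q "as @ [b]"] *(8) by (auto simp: hd_append)
  have d: "distinct p"
    using *(1) split_choice_path segment_path_distinct by blast
  have "hd as = hd xs"
    using *(2,4,7,8) by (metis hd_append2)
  moreover have "v \<in> set q"
    using v(1) by blast
  moreover have "hd xs \<notin> set q"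
    using d *(2,4) by (cases xs) auto
  ultimately have "v \<noteq> hd as"
    by auto
  then have vb: "v = b"
    using v by blast
  show False
  proof (cases "v = hd q")
    case True
    obtain q' where q: "q = b # q'"
      using True vb *(3) by (cases q) auto
    have "as @ b # bs = xs @ b # q' @ ys"
      using *(2,7) q by simp
    then have "as = xs" "bs = q' @ ys"
      using d[unfolded *(7)] distinct_split_unique by metis+
    then show False
      using split_choice_break[OF *(1,7,8,9)] *(6,10) q by simp
  next
    case False
    then obtain q' where q: "q = q' @ [b]" "q' \<noteq> []"
      using v(2) vb snoc_of_length_ge_2[OF *(3)] by (metis last_snoc)
    have "as @ b # bs = (xs @ q') @ b # ys"
      using *(2,7) q by simp
    then have "as = xs @ q'"
      using d[unfolded *(7)] distinct_split_unique by metis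
    then have "set q' \<subseteq> {b}"
      using v(1) q vb by auto
    then show False
      using q d[unfolded *(2)] by (cases q') auto
  qed
qed

text \<open>An inner piece contains neither end of \<open>p\<close>, so it is no split of
  \<open>p\<close>. Composability with final pieces in \<open>D\<close> is refuted like that with
  initial ones, after reversing \<open>p\<close>.\<close>

lemma middle_in_residual_splits:
  assumes sc: "split_choice T p D"
    and q: "p = xs @ q @ ys" "2 \<le> length q" "xs \<noteq> []" "ys \<noteq> []" "unoriented (q @ ys) \<in> D" "unoriented (xs @ q) \<in> D"
  shows "unoriented q \<in> residual_splits T (unoriented p, D) (unoriented (xs @ q))"
proof -
  have seg: "segment_path T p" "distinct p"
    using split_choice_path[OF sc] segment_path_distinct by auto
  obtain c cs where c: "q = c # cs" "cs \<noteq> []"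
    using q(2) Cons_of_length_ge_2 by blast
  have segx: "segment_path T (xs @ q)"
    using segment_path_infix[of T "[]" "xs @ q" ys] seg(1) q by simp
  have "unoriented q \<in> splits T (unoriented (xs @ q))"
    unfolding splits_unoriented[OF segx] using c q(3) by blast
  moreover have "unoriented q \<notin> splits T (unoriented p)"
  proof
    assume "unoriented q \<in> splits T (unoriented p)"
    then have "hd p \<in> set q \<or> last p \<in> set q"
      unfolding splits_unoriented[OF seg(1)] by (fastforce dest!: unoriented_eq_set)
    then show False
      using q(1-4) seg(2) by (cases xs; cases ys rule: rev_cases) auto
  qed
  moreover have "\<not> composable T (unoriented q) d" if "d \<in> D" for d
    using sc that
  proof (cases rule: split_choice_cases)
    case (1 as' b' bs')
    then show ?thesis
      using middle_not_composable_prefix[OF sc q(1-5)] that by blast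
  next
    case (2 as' b' bs')
    then have d: "d = unoriented (rev bs' @ [b'])" "rev p = rev bs' @ b' # rev as'"
      using unoriented_rev[of "b' # bs'"] by (auto simp del: unoriented_rev)
    moreover have "unoriented (rev q @ rev xs) \<in> D"
      using q(6) unoriented_rev[of "xs @ q"] by (simp del: unoriented_rev)
    ultimately show ?thesis
      using middle_not_composable_prefix[OF split_choice_rev[OF sc], of "rev ys" "rev q" "rev xs" "rev bs'" b' "rev as'"]
        q(1-4) 2(2,3) that
      by simp
  qed
  ultimately show ?thesis
    by (auto simp: residual_splits_def)
qed

text \<open>The three constituents of \<open>J\<close> correspond to the position of a piece: the
  whole path, pieces reaching exactly one end (the members of \<open>D\<close>), and inner pieces
  (the residual splits).\<close>

lemma J_eq_pieces:
  assumes "split_choice T p D"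
  shows "J T (unoriented p, D) = J_pieces p D"
proof -
  have sub: "residual_splits T (unoriented p, D) d \<subseteq> J_pieces p D" if "d \<in> D" for d
    using assms that
  proof (cases rule: split_choice_cases)
    case (1 xs b ys)
    then show ?thesis
      using residual_splits_subset_J_pieces[OF assms, of xs b ys] that by simp
  next
    case (2 xs b ys)
    then have "d = unoriented (rev ys @ [b])" "rev p = rev ys @ b # rev xs"
      using unoriented_rev[of "b # ys"] by (auto simp del: unoriented_rev)
    then have "residual_splits T (unoriented (rev p), D) d \<subseteq> J_pieces (rev p) D"
      using residual_splits_subset_J_pieces[OF split_choice_rev[OF assms], of "rev ys" b "rev xs"] that 2(2,3)
      by simp
    then show ?thesis
      by simp
  qed
  have D: "d \<in> J_pieces p D" if "d \<in> D" for d
    using assms that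
  proof (cases rule: split_choice_cases)
    case (1 xs b ys)
    then show ?thesis
      using J_piecesI[of p "[]" "xs @ [b]" ys D] that by (simp add: Suc_le_eq)
  next
    case (2 xs b ys)
    then show ?thesis
      using J_piecesI[of p xs "b # ys" "[]" D] that by (simp add: Suc_le_eq)
  qed
  have p: "unoriented p \<in> J_pieces p D"
    using J_piecesI[of p "[]" p "[]" D] segment_path_length[OF split_choice_path[OF assms]] by simp
  show ?thesis
  proof (intro equalityI subsetI)
    fix s assume "s \<in> J T (unoriented p, D)"
    then show "s \<in> J_pieces p D"
      using sub D p by (auto simp: J_def)
  next
    fix s assume "s \<in> J_pieces p D"
    then obtain xs q ys where s: "s = unoriented q" and q: "p = xs @ q @ ys" "2 \<le> length q"
      "xs \<noteq> [] \<longrightarrow> unoriented (q @ ys) \<in> D" "ys \<noteq> [] \<longrightarrow> unoriented (xs @ q) \<in> D"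
      unfolding J_pieces_def by blast
    show "s \<in> J T (unoriented p, D)"
      using middle_in_residual_splits[OF assms] q s by (cases "xs = []"; cases "ys = []") (auto simp: J_def)
  qed
qed

section \<open>Biclosedness and minimality of the sets of pieces\<close>

lemma mem_Seg_of_biclosed: "biclosed T B \<Longrightarrow> unoriented q \<in> B \<Longrightarrow> segment_path T q"
  using biclosed_subset unoriented_in_Seg by blast

lemma split_choice_distinct: "split_choice T p D \<Longrightarrow> distinct p"
  using split_choice_path segment_path_distinct by blast

lemma self_in_J_pieces: "segment_path T p \<Longrightarrow> unoriented p \<in> J_pieces p D"
  using J_piecesI[of p "[]" p "[]" D] segment_path_length[of T p] by simp

text \<open>Here \<open>r\<close> keeps its orientation and \<open>p\<close> is reversed if
  necessary, which suits arguments that cut \<open>r\<close> at a vertex.\<close>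

lemma J_piecesE:
  assumes "unoriented r \<in> J_pieces p D"
  obtains p' xs ys where "p' = p \<or> p' = rev p" "p' = xs @ r @ ys"
    "xs \<noteq> [] \<Longrightarrow> unoriented (r @ ys) \<in> D" "ys \<noteq> [] \<Longrightarrow> unoriented (xs @ r) \<in> D"
proof -
  obtain xs q ys where *: "unoriented r = unoriented q" "p = xs @ q @ ys"
    "xs \<noteq> [] \<longrightarrow> unoriented (q @ ys) \<in> D" "ys \<noteq> [] \<longrightarrow> unoriented (xs @ q) \<in> D"
    using assms unfolding J_pieces_def by blast
  have "r = q \<or> r = rev q"
    using *(1) by (simp add: unoriented_eq_iff)
  then show ?thesis
  proof
    assume "r = q"
    then show ?thesis
      using that[of p xs ys] * by blast
  next
    assume r: "r = rev q"
    have "unoriented (r @ rev xs) = unoriented (xs @ q)" "unoriented (rev ys @ r) = unoriented (q @ ys)"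
      using unoriented_rev[of "xs @ q"] unoriented_rev[of "q @ ys"] by (simp_all add: r del: unoriented_rev)
    then show ?thesis
      using that[of "rev p" "rev ys" "rev xs"] * r by auto
  qed
qed

text \<open>With the next lemma this makes \<open>p\<close> the only longest segment of its set of
  pieces, so the set determines the segment.\<close>

lemma J_pieces_length_le:
  assumes "unoriented r \<in> J_pieces p D"
  shows "length r \<le> length p"
proof -
  obtain p' xs ys where "p' = p \<or> p' = rev p" "p' = xs @ r @ ys"
    using assms by (rule J_piecesE)
  then show ?thesis
    by (metis length_append length_rev le_add1 le_add2 le_trans)
qed

lemma J_pieces_same_length:
  assumes "unoriented r \<in> J_pieces p D" "length r = length p"
  shows "unoriented r = unoriented p"
proof -
  obtain p' xs ys where *: "p' = p \<or> p' = rev p" "p' = xs @ r @ ys"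
    using assms(1) by (rule J_piecesE)
  moreover from this have "length p' = length p"
    by (metis length_rev)
  ultimately have "p' = r"
    using assms(2) by simp
  then show ?thesis
    using *(1) by auto
qed

lemma J_pieces_subset_Seg:
  assumes "segment_path T p"
  shows "J_pieces p D \<subseteq> Seg T"
  using assms segment_path_infix unfolding J_pieces_def by fastforce

text \<open>If both segments run in the same direction along \<open>p\<close>, then both sides of
  the break of \<open>p\<close> at \<open>b\<close> are in \<open>D\<close>. Otherwise they lie on
  the same side of \<open>b\<close> and share its neighbour there, against distinctness.\<close>

lemma J_pieces_not_joinable:
  assumes sc: "split_choice T p D" and d: "distinct (as @ b # bs)" and ne: "as \<noteq> []" "bs \<noteq> []"
    and J: "unoriented (as @ [b]) \<in> J_pieces p D" "unoriented (b # bs) \<in> J_pieces p D"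
  shows False
proof -
  obtain p' xs ys where p': "p' = p \<or> p' = rev p" "p' = (xs @ as) @ b # ys"
    and ys: "ys \<noteq> [] \<Longrightarrow> unoriented ((xs @ as) @ [b]) \<in> D"
    using J(1) by (elim J_piecesE) simp
  have sc': "split_choice T p' D"
    using sc split_choice_rev p' by blast
  then have d': "distinct ((xs @ as) @ b # ys)"
    using split_choice_distinct p' by metis
  have "unoriented (b # bs) \<in> J_pieces p' D"
    using J(2) p' by auto
  then obtain xs2 q ys2 where q: "p' = xs2 @ q @ ys2" "unoriented (b # bs) = unoriented q"
    "xs2 \<noteq> [] \<longrightarrow> unoriented (q @ ys2) \<in> D"
    unfolding J_pieces_def by blast
  have "q = b # bs \<or> q = rev bs @ [b]"
    using q(2) unoriented_eq_iff[of q "b # bs"] by auto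
  then show False
  proof
    assume "q = b # bs"
    then have "(xs @ as) @ b # ys = xs2 @ b # bs @ ys2"
      using p' q by simp
    from distinct_split_unique[OF d' this] have "xs2 = xs @ as" "ys = bs @ ys2"
      by auto
    moreover from this have "unoriented (b # ys) \<in> D"
      using q \<open>q = b # bs\<close> ne by simp
    ultimately show False
      using split_choice_break[OF sc' p'(2)] ys ne by simp
  next
    assume "q = rev bs @ [b]"
    then have "(xs @ as) @ b # ys = (xs2 @ rev bs) @ b # ys2"
      using p' q by simp
    from distinct_split_unique[OF d' this] have "last (xs @ as) = last (xs2 @ rev bs)"
      by simp
    then have "last as = hd bs"
      using ne by (simp add: last_append last_rev)
    then show False
      using d ne by (metis UnCI disjoint_iff distinct_append hd_in_set last_in_set list.set_intros(2))
  qed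
qed

text \<open>Closedness holds vacuously by \<open>J_pieces_not_joinable\<close>. For the complement,
  the side of the break of \<open>p\<close> at \<open>b\<close> that lies in \<open>D\<close> tells
  which half of the piece belongs to the set.\<close>

lemma biclosed_J_pieces:
  assumes sc: "split_choice T p D"
  shows "biclosed T (J_pieces p D)"
  unfolding biclosed_iff
proof (intro conjI allI impI)
  show "J_pieces p D \<subseteq> Seg T"
    using J_pieces_subset_Seg split_choice_path[OF sc] .
next
  fix xs b ys
  assume "xs \<noteq> []" "ys \<noteq> []" "segment_path T (xs @ b # ys)" "unoriented (xs @ [b]) \<in> J_pieces p D"
    "unoriented (b # ys) \<in> J_pieces p D"
  then show "unoriented (xs @ b # ys) \<in> J_pieces p D"
    using J_pieces_not_joinable[OF sc] segment_path_distinct by metis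
next
  fix as b bs
  assume ne: "as \<noteq> []" "bs \<noteq> []" and "unoriented (as @ b # bs) \<in> J_pieces p D"
  from this(3) obtain p' xs ys where p': "p' = p \<or> p' = rev p" "p' = (xs @ as) @ b # bs @ ys"
    and D: "xs \<noteq> [] \<Longrightarrow> unoriented (as @ b # bs @ ys) \<in> D" "ys \<noteq> [] \<Longrightarrow> unoriented (xs @ as @ b # bs) \<in> D"
    by (elim J_piecesE) simp
  have sc': "split_choice T p' D" and J': "J_pieces p D = J_pieces p' D"
    using sc split_choice_rev p' by auto
  have "unoriented (xs @ as @ [b]) \<in> D \<or> unoriented (b # bs @ ys) \<in> D"
    using split_choice_break[OF sc' p'(2)] ne by auto
  then show "unoriented (as @ [b]) \<in> J_pieces p D \<or> unoriented (b # bs) \<in> J_pieces p D"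
  proof
    assume *: "unoriented (xs @ as @ [b]) \<in> D"
    have "unoriented (as @ [b]) \<in> J_pieces p' D"
      using J_piecesI[of p' xs "as @ [b]" "bs @ ys" D] * D p' ne by (simp add: Suc_le_eq)
    then show ?thesis
      using J' by simp
  next
    assume *: "unoriented (b # bs @ ys) \<in> D"
    have "unoriented (b # bs) \<in> J_pieces p' D"
      using J_piecesI[of p' "xs @ as" "b # bs" ys D] * D p' ne by (simp add: Suc_le_eq)
    then show ?thesis
      using J' by simp
  qed
qed

text \<open>A split in the set but not in \<open>D\<close> would have its opposite split in
  \<open>D\<close>, and the two would be joinable members of the set.\<close>

lemma J_pieces_inter_splits:
  assumes sc: "split_choice T p D"
  shows "J_pieces p D \<inter> splits T (unoriented p) = D"
proof (intro equalityI subsetI)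
  fix d assume d: "d \<in> D"
  have "d \<in> J_pieces p D"
    using sc d
  proof (cases rule: split_choice_cases)
    case (1 xs b ys)
    then show ?thesis
      using J_piecesI[of p "[]" "xs @ [b]" ys D] d by (simp add: Suc_le_eq)
  next
    case (2 xs b ys)
    then show ?thesis
      using J_piecesI[of p xs "b # ys" "[]" D] d by (simp add: Suc_le_eq)
  qed
  then show "d \<in> J_pieces p D \<inter> splits T (unoriented p)"
    using sc d unfolding split_choice_def by blast
next
  fix d assume d: "d \<in> J_pieces p D \<inter> splits T (unoriented p)"
  then obtain xs b ys where p: "p = xs @ b # ys" "xs \<noteq> []" "ys \<noteq> []"
    and cases: "d = unoriented (xs @ [b]) \<or> d = unoriented (b # ys)"
    unfolding splits_unoriented[OF split_choice_path[OF sc]] by blast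
  have "\<not> (unoriented (xs @ [b]) \<in> J_pieces p D \<and> unoriented (b # ys) \<in> J_pieces p D)"
    using J_pieces_not_joinable[OF sc, of xs b ys] split_choice_distinct[OF sc] p by blast
  moreover have "unoriented (xs @ [b]) \<in> J_pieces p D" if "unoriented (xs @ [b]) \<in> D"
    using J_piecesI[of p "[]" "xs @ [b]" ys D] p that by (simp add: Suc_le_eq)
  moreover have "unoriented (b # ys) \<in> J_pieces p D" if "unoriented (b # ys) \<in> D"
    using J_piecesI[of p xs "b # ys" "[]" D] p that by (simp add: Suc_le_eq)
  ultimately show "d \<in> D"
    using split_choice_break[OF sc p] cases d by auto
qed

text \<open>Biclosedness puts a piece of each break of \<open>p\<close> into \<open>B\<close>, and
  only the one in \<open>D\<close> is allowed, so \<open>D\<close> lies in \<open>B\<close>. For an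
  inner piece \<open>q\<close>, break the member \<open>xs @ q\<close> of \<open>D\<close> at the
  first vertex of \<open>q\<close>: the part \<open>xs @ [b]\<close> is not in \<open>D\<close>,
  hence not in \<open>B\<close>, so \<open>q\<close> is in \<open>B\<close>.\<close>

lemma J_pieces_least:
  assumes sc: "split_choice T p D" and B: "biclosed T B" "unoriented p \<in> B"
    and BD: "B \<inter> splits T (unoriented p) \<subseteq> D"
  shows "J_pieces p D \<subseteq> B"
proof
  have spl: "unoriented (xs @ [b]) \<in> splits T (unoriented p)" "unoriented (b # ys) \<in> splits T (unoriented p)"
    if "p = xs @ b # ys" "xs \<noteq> []" "ys \<noteq> []" for xs b ys
    using that unfolding splits_unoriented[OF split_choice_path[OF sc]] by blast+
  have DB: "D \<subseteq> B"
  proof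
    fix d assume d: "d \<in> D"
    show "d \<in> B"
      using sc d
    proof (cases rule: split_choice_cases)
      case (1 xs b ys)
      then show ?thesis
        using biclosed_break[OF B(1), of xs b ys] split_choice_break[OF sc 1(1-3)] spl[OF 1(1-3)] B(2) BD d by auto
    next
      case (2 xs b ys)
      then show ?thesis
        using biclosed_break[OF B(1), of xs b ys] split_choice_break[OF sc 2(1-3)] spl[OF 2(1-3)] B(2) BD d by auto
    qed
  qed
  fix s assume "s \<in> J_pieces p D"
  then obtain xs q ys where s: "s = unoriented q" and q: "p = xs @ q @ ys" "2 \<le> length q"
      "xs \<noteq> [] \<longrightarrow> unoriented (q @ ys) \<in> D" "ys \<noteq> [] \<longrightarrow> unoriented (xs @ q) \<in> D"
    unfolding J_pieces_def by blast
  show "s \<in> B"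
  proof (cases "xs = [] \<or> ys = []")
    case True
    then show ?thesis
      using s q B(2) DB by auto
  next
    case False
    obtain b as where b: "q = b # as" "as \<noteq> []"
      using q(2) Cons_of_length_ge_2 by blast
    have p: "p = xs @ b # (as @ ys)" "xs \<noteq> []" "as @ ys \<noteq> []"
      using q b False by auto
    have "unoriented (xs @ b # as) \<in> B"
      using q(4) False b DB by auto
    then have "unoriented (xs @ [b]) \<in> B \<or> s \<in> B"
      using biclosed_break[OF B(1)] False b s by blast
    moreover have "unoriented (xs @ [b]) \<notin> D"
      using split_choice_break[OF sc p] q(3) b False by simp
    ultimately show ?thesis
      using spl[OF p] BD by blast
  qed
qed

lemma J_pieces_inject:
  assumes "split_choice T p D" "split_choice T p' D'" "J_pieces p D = J_pieces p' D'"
  shows "unoriented p = unoriented p'" "D = D'"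
proof -
  have *: "unoriented p \<in> J_pieces p' D'" "unoriented p' \<in> J_pieces p D"
    using assms self_in_J_pieces split_choice_path by metis+
  then have "length p = length p'"
    by (meson J_pieces_length_le order_antisym)
  then show "unoriented p = unoriented p'"
    using J_pieces_same_length * by blast
  then show "D = D'"
    using J_pieces_inter_splits[OF assms(1)] J_pieces_inter_splits[OF assms(2)] assms(3) by simp
qed

section \<open>Removing a single segment from a biclosed set\<close>

text \<open>The hypothesis \<open>nd\<close> keeps the set closed without \<open>p\<close>. The
  hypothesis \<open>ext\<close> keeps the complement closed: a member of \<open>x\<close> that
  properly extends \<open>p\<close> still has a piece of that break in the set.\<close>

lemma biclosed_remove:
  assumes x: "biclosed T x"
    and nd: "\<And>xs b ys. \<lbrakk>p = xs @ b # ys; xs \<noteq> []; ys \<noteq> []; unoriented (xs @ [b]) \<in> x; unoriented (b # ys) \<in> x\<rbrakk> \<Longrightarrow> False"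
    and ext: "\<And>xs b ys. \<lbrakk>unoriented (xs @ [b]) = unoriented p; ys \<noteq> []; unoriented (xs @ b # ys) \<in> x\<rbrakk> \<Longrightarrow>
      unoriented (b # ys) \<in> x"
  shows "biclosed T (x - {unoriented p})"
  unfolding biclosed_iff
proof (intro conjI allI impI)
  show "x - {unoriented p} \<subseteq> Seg T"
    using biclosed_subset[OF x] by blast
next
  fix xs b ys
  assume ne: "xs \<noteq> []" "ys \<noteq> []" and seg: "segment_path T (xs @ b # ys)"
    and *: "unoriented (xs @ [b]) \<in> x - {unoriented p}" "unoriented (b # ys) \<in> x - {unoriented p}"
  have "unoriented (xs @ b # ys) \<noteq> unoriented p"
  proof
    assume "unoriented (xs @ b # ys) = unoriented p"
    then have "p = xs @ b # ys \<or> p = rev ys @ b # rev xs"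
      using unoriented_eq_iff[of p "xs @ b # ys"] by auto
    moreover have "unoriented (rev ys @ [b]) \<in> x" "unoriented (b # rev xs) \<in> x"
      using * unoriented_rev[of "b # ys"] unoriented_rev[of "xs @ [b]"] by (simp_all del: unoriented_rev)
    ultimately show False
      using nd[of xs b ys] nd[of "rev ys" b "rev xs"] ne * by auto
  qed
  then show "unoriented (xs @ b # ys) \<in> x - {unoriented p}"
    using biclosed_join[OF x ne seg] * by blast
next
  fix xs b ys
  assume ne: "xs \<noteq> []" "ys \<noteq> []" and seg: "segment_path T (xs @ b # ys)"
    and *: "unoriented (xs @ b # ys) \<in> x - {unoriented p}"
  have neq: "unoriented (xs @ [b]) \<noteq> unoriented (b # ys)"
    using breaks_ends_neq[of xs b ys] segment_path_distinct[OF seg] ne by simp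
  have "unoriented (b # ys) \<in> x" if "unoriented (xs @ [b]) = unoriented p"
    using ext[OF that] ne * by blast
  moreover have "unoriented (xs @ [b]) \<in> x" if "unoriented (b # ys) = unoriented p"
    using ext[of "rev ys" b "rev xs"] that ne * unoriented_rev[of "b # ys"] unoriented_rev[of "xs @ [b]"]
      unoriented_rev[of "xs @ b # ys"]
    by (simp del: unoriented_rev)
  ultimately show "unoriented (xs @ [b]) \<in> x - {unoriented p} \<or> unoriented (b # ys) \<in> x - {unoriented p}"
    using biclosed_break[OF x, of xs b ys] ne * neq by auto
qed

text \<open>No member is longer than \<open>p\<close>, so nothing extends \<open>p\<close>. The
  resulting set is the one element covered by \<open>J_pieces p D\<close>, which makes the latter
  join-irreducible.\<close>

lemma biclosed_J_pieces_remove: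
  assumes "split_choice T p D"
  shows "biclosed T (J_pieces p D - {unoriented p})"
  using biclosed_J_pieces[OF assms]
proof (rule biclosed_remove)
  fix xs b ys
  assume "p = xs @ b # ys" "xs \<noteq> []" "ys \<noteq> []" "unoriented (xs @ [b]) \<in> J_pieces p D" "unoriented (b # ys) \<in> J_pieces p D"
  then show False
    using J_pieces_not_joinable[OF assms] split_choice_distinct[OF assms] by metis
next
  fix xs b ys
  assume "unoriented (xs @ [b]) = unoriented p" "ys \<noteq> []" "unoriented (xs @ b # ys) \<in> J_pieces p D"
  then have "length (xs @ b # ys) \<le> length p" "length (xs @ [b]) = length p"
    using J_pieces_length_le unoriented_eq_length by blast+
  then show "unoriented (b # ys) \<in> J_pieces p D"
    using \<open>ys \<noteq> []\<close> by (cases ys) auto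
qed

section \<open>Joins\<close>

text \<open>Iterated composition as a binary tree of oriented paths, so that an induction meets one
  joint at a time; orientation is forgotten only in \<open>concat_closure\<close>.\<close>

inductive concat_path :: "'v plane_graph \<Rightarrow> 'v list set set \<Rightarrow> 'v list \<Rightarrow> bool" for T S where
  base: "\<lbrakk>segment_path T q; unoriented q \<in> S\<rbrakk> \<Longrightarrow> concat_path T S q"
| comp: "\<lbrakk>xs \<noteq> []; ys \<noteq> []; segment_path T (xs @ b # ys); concat_path T S (xs @ [b]); concat_path T S (b # ys)\<rbrakk>
    \<Longrightarrow> concat_path T S (xs @ b # ys)"

definition concat_closure :: "'v plane_graph \<Rightarrow> 'v list set set \<Rightarrow> 'v list set set" where
  "concat_closure T S = {unoriented q | q. concat_path T S q}"

lemma concat_path_segment_path: "concat_path T S q \<Longrightarrow> segment_path T q"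
  by (erule concat_path.cases) auto

lemma concat_path_rev: "concat_path T S q \<Longrightarrow> concat_path T S (rev q)"
proof (induction rule: concat_path.induct)
  case (comp xs ys b)
  then show ?case
    using concat_path.comp[of "rev ys" "rev xs" T b S] segment_path_rev[OF comp.hyps(3)] by simp
qed (auto intro: concat_path.base)

lemma in_concat_closure [simp]: "unoriented q \<in> concat_closure T S \<longleftrightarrow> concat_path T S q"
  unfolding concat_closure_def using concat_path_rev by (auto simp: unoriented_eq_iff)

lemma subset_concat_closure:
  assumes "S \<subseteq> Seg T"
  shows "S \<subseteq> concat_closure T S"
proof
  fix s assume s: "s \<in> S"
  then obtain q where "s = unoriented q" "segment_path T q"
    using assms by (blast elim: Seg_cases)
  then show "s \<in> concat_closure T S"
    using s by (simp add: concat_path.base)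
qed

lemma concat_closure_least:
  assumes "biclosed T C" "S \<subseteq> C"
  shows "concat_closure T S \<subseteq> C"
proof -
  have "unoriented q \<in> C" if "concat_path T S q" for q
    using that
  proof induction
    case (comp xs ys b)
    then show ?case
      using biclosed_join[OF assms(1)] by blast
  qed (use assms(2) in blast)
  then show ?thesis
    by (auto simp: concat_closure_def)
qed

text \<open>The cases follow the relative position of the two cut vertices: \<open>c\<close> before,
  at, or after \<open>b\<close>.\<close>

lemma split_compare:
  assumes "xs @ b # ys = as @ c # bs"
  obtains zs where "xs = as @ c # zs" "bs = zs @ b # ys"
  | "as = xs" "c = b" "bs = ys"
  | zs where "as = xs @ b # zs" "ys = zs @ c # bs"
  using assms by (auto simp: append_eq_append_conv2 Cons_eq_append_conv append_eq_Cons_conv)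

lemma segment_path_suffix: "\<lbrakk>segment_path T (xs @ b # ys @ c # zs)\<rbrakk> \<Longrightarrow> segment_path T (b # ys @ c # zs)"
  using segment_path_infix[of T xs "b # ys @ c # zs" "[]"] by simp

lemma segment_path_prefix: "\<lbrakk>segment_path T (xs @ b # ys @ c # zs)\<rbrakk> \<Longrightarrow> segment_path T (xs @ b # ys @ [c])"
  using segment_path_infix[of T "[]" "xs @ b # ys @ [c]" zs] by simp

text \<open>A vertex inside a concatenation is a joint or lies inside one part. In the latter case
  that part belongs to some biclosed \<open>B\<close> and leaves one half in \<open>B\<close>, which
  the remaining parts on its side extend. Hence closing a union of biclosed sets under composition
  already gives a biclosed set.\<close>

lemma concat_path_break:
  assumes "\<And>B. B \<in> F \<Longrightarrow> biclosed T B"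
  shows "\<lbrakk>concat_path T (\<Union>F) q; q = as @ b # bs; as \<noteq> []; bs \<noteq> []\<rbrakk> \<Longrightarrow>
     concat_path T (\<Union>F) (as @ [b]) \<or> concat_path T (\<Union>F) (b # bs)"
proof (induction arbitrary: as b bs rule: concat_path.induct)
  case (base q)
  then obtain B where "B \<in> F" "unoriented (as @ b # bs) \<in> B"
    by blast
  then have "unoriented (as @ [b]) \<in> \<Union>F \<or> unoriented (b # bs) \<in> \<Union>F"
    using biclosed_break[OF assms] base by blast
  moreover have "segment_path T (as @ [b])" "segment_path T (b # bs)"
    using base segment_path_pieces[of T as b bs] by simp_all
  ultimately show ?case
    by (blast intro: concat_path.base)
next
  case (comp xs ys c)
  from comp.prems(1) show ?case
  proof (cases rule: split_compare)
    case (1 zs)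
    then have "concat_path T (\<Union>F) (as @ [b]) \<or> concat_path T (\<Union>F) (b # zs @ [c])"
      using comp.IH(1)[of as b "zs @ [c]"] comp.prems(2) by simp
    moreover have "concat_path T (\<Union>F) (b # zs @ c # ys)" if "concat_path T (\<Union>F) (b # zs @ [c])"
      using concat_path.comp[of "b # zs" ys T c "\<Union>F"] segment_path_suffix[of T as b zs c ys] that comp.hyps(2,3,5) 1(1) by simp
    ultimately show ?thesis
      using 1(2) by blast
  next
    case 2
    then show ?thesis
      using comp.hyps(5) by simp
  next
    case (3 zs)
    then have "concat_path T (\<Union>F) (c # zs @ [b]) \<or> concat_path T (\<Union>F) (b # bs)"
      using comp.IH(2)[of "c # zs" b bs] comp.prems(3) by simp
    moreover have "concat_path T (\<Union>F) (xs @ c # zs @ [b])" if "concat_path T (\<Union>F) (c # zs @ [b])"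
      using concat_path.comp[of xs "zs @ [b]" T c "\<Union>F"] segment_path_prefix[of T xs c zs b bs] that comp.hyps(1,3,4) 3(2) by simp
    ultimately show ?thesis
      using 3(1) by auto
  qed
qed

lemma biclosed_concat_closure:
  assumes "\<And>B. B \<in> F \<Longrightarrow> biclosed T B"
  shows "biclosed T (concat_closure T (\<Union>F))"
  unfolding biclosed_iff in_concat_closure
proof (intro conjI allI impI)
  show "concat_closure T (\<Union>F) \<subseteq> Seg T"
    by (auto simp: concat_closure_def concat_path_segment_path)
next
  fix xs b ys
  assume "xs \<noteq> []" "ys \<noteq> []" "segment_path T (xs @ b # ys)" "concat_path T (\<Union>F) (xs @ [b])" "concat_path T (\<Union>F) (b # ys)"
  then show "concat_path T (\<Union>F) (xs @ b # ys)"
    by (rule concat_path.comp)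
next
  fix xs b ys
  assume "xs \<noteq> []" "ys \<noteq> []" "concat_path T (\<Union>F) (xs @ b # ys)"
  then show "concat_path T (\<Union>F) (xs @ [b]) \<or> concat_path T (\<Union>F) (b # ys)"
    using concat_path_break[OF assms] by blast
qed

section \<open>The lattice operations of \<open>Bic T\<close>\<close>

lemma carrier_Bic [simp]: "carrier (Bic T) = {B. biclosed T B}"
  and le_Bic [simp]: "x \<sqsubseteq>\<^bsub>Bic T\<^esub> y \<longleftrightarrow> x \<subseteq> y"
  by (simp_all add: Bic_def)

lemma sup_Bic:
  assumes "\<And>B. B \<in> F \<Longrightarrow> biclosed T B"
  shows "\<Squnion>\<^bsub>Bic T\<^esub>F = concat_closure T (\<Union>F)"
proof -
  have "\<Union>F \<subseteq> concat_closure T (\<Union>F)"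
    using assms biclosed_subset by (intro subset_concat_closure) blast
  moreover have "concat_closure T (\<Union>F) \<subseteq> C" if "biclosed T C" "\<And>B. B \<in> F \<Longrightarrow> B \<subseteq> C" for C
    using that by (intro concat_closure_least) blast+
  ultimately have 1: "least (Bic T) (concat_closure T (\<Union>F)) (Upper (Bic T) F)"
    using assms biclosed_concat_closure[of F T] unfolding least_def Upper_def le_Bic carrier_Bic by blast
  show ?thesis
    unfolding sup_def
  \<comment> \<open>The join is defined by a choice operator, so uniqueness of the least upper bound
    is needed to evaluate it.\<close>
  proof (rule some_equality[where P = "\<lambda>x. least (Bic T) x (Upper (Bic T) F)", OF 1])
    fix x assume "least (Bic T) x (Upper (Bic T) F)"
    then show "x = concat_closure T (\<Union>F)"
      using 1 unfolding least_def le_Bic by blast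
  qed
qed

lemma bottom_Bic: "\<bottom>\<^bsub>Bic T\<^esub> = {}"
proof -
  have 1: "least (Bic T) {} (carrier (Bic T))"
    by (simp add: least_def biclosed_iff)
  show ?thesis
    unfolding bottom_def
  proof (rule some_equality[where P = "\<lambda>x. least (Bic T) x (carrier (Bic T))", OF 1])
    fix x assume "least (Bic T) x (carrier (Bic T))"
    then show "x = {}"
      using 1 by (auto simp: least_def)
  qed
qed

lemma biclosed_sup_Bic: "(\<And>B. B \<in> F \<Longrightarrow> biclosed T B) \<Longrightarrow> biclosed T (\<Squnion>\<^bsub>Bic T\<^esub>F)"
  by (simp add: sup_Bic biclosed_concat_closure)

lemma sup_Bic_upper:
  assumes "\<And>B. B \<in> F \<Longrightarrow> biclosed T B" "B \<in> F"
  shows "B \<subseteq> \<Squnion>\<^bsub>Bic T\<^esub>F"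
proof -
  have "\<Union>F \<subseteq> Seg T"
    using assms(1) biclosed_subset by blast
  then show ?thesis
    using assms subset_concat_closure[of "\<Union>F" T] sup_Bic[of F T] by blast
qed

lemma sup_Bic_least:
  assumes "biclosed T C" "\<And>B. B \<in> F \<Longrightarrow> biclosed T B \<and> B \<subseteq> C"
  shows "\<Squnion>\<^bsub>Bic T\<^esub>F \<subseteq> C"
  using assms sup_Bic[of F T] concat_closure_least[of T C "\<Union>F"] by auto

text \<open>By minimality, a biclosed subset containing \<open>p\<close> is the whole set. Two
  proper joinands therefore lie in the biclosed set without \<open>p\<close>, and so does their
  join.\<close>

lemma J_pieces_in_JI:
  assumes sc: "split_choice T p D"
  shows "J_pieces p D \<in> JI (Bic T)"
proof -
  have p: "unoriented p \<in> J_pieces p D"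
    using self_in_J_pieces split_choice_path[OF sc] by blast
  have "J_pieces p D \<in> {x, y}"
    if xy: "biclosed T x" "biclosed T y" and J: "J_pieces p D = x \<squnion>\<^bsub>Bic T\<^esub> y" for x y
  proof (rule ccontr)
    assume neq: "J_pieces p D \<notin> {x, y}"
    have sub: "z \<subseteq> J_pieces p D - {unoriented p}" if "z \<in> {x, y}" for z
    proof -
      have "z \<subseteq> \<Squnion>\<^bsub>Bic T\<^esub>{x, y}"
        using that xy by (intro sup_Bic_upper) auto
      then have z: "z \<subseteq> J_pieces p D"
        by (simp only: J join_def)
      have "z \<noteq> J_pieces p D" "biclosed T z"
        using that neq xy by auto
      then have "unoriented p \<notin> z"
        using J_pieces_least[OF sc, of z] J_pieces_inter_splits[OF sc] z by blast
      then show ?thesis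
        using z by blast
    qed
    have "\<Squnion>\<^bsub>Bic T\<^esub>{x, y} \<subseteq> J_pieces p D - {unoriented p}"
      using biclosed_J_pieces_remove[OF sc] sub xy by (intro sup_Bic_least) auto
    then show False
      using p J unfolding join_def by blast
  qed
  then show ?thesis
    using p biclosed_J_pieces[OF sc] by (auto simp: JI_def bottom_Bic)
qed

section \<open>Covering relations\<close>

text \<open>Call a segment of \<open>x - y\<close> good if \<open>y\<close> meets all its breaks; a
  longest good segment is inserted. A shortest segment of \<open>x - y\<close> is good, because
  \<open>x\<close> meets its breaks in shorter segments, which must lie in \<open>y\<close>.
  Goodness keeps the complement closed, maximal length keeps the set closed.\<close>

lemma biclosed_insert_exists:
  assumes fin: "plane_tree T" and y: "biclosed T y" and x: "biclosed T x" and yx: "y \<subset> x"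
  shows "\<exists>u \<in> x - y. biclosed T (insert u y)"
proof -
  define good where "good w \<longleftrightarrow> unoriented w \<in> x - y \<and> (\<forall>as b bs. w = as @ b # bs \<longrightarrow> as \<noteq> [] \<longrightarrow> bs \<noteq> [] \<longrightarrow>
      unoriented (as @ [b]) \<in> y \<or> unoriented (b # bs) \<in> y)" for w
  have good_mem: "unoriented w \<in> x" "unoriented w \<notin> y" if "good w" for w
    using that by (simp_all add: good_def)
  have good_break: "unoriented (as @ [b]) \<in> y \<or> unoriented (b # bs) \<in> y"
    if "good (as @ b # bs)" "as \<noteq> []" "bs \<noteq> []" for as b bs
    using that unfolding good_def by blast
  have good_rev: "good (rev w)" if "good w" for w
    unfolding good_def
  proof (intro conjI allI impI)
    fix as b bs
    assume "rev w = as @ b # bs" "as \<noteq> []" "bs \<noteq> []"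
    moreover from this(1) have "w = rev bs @ b # rev as"
      by (metis append.assoc append_Cons append_Nil rev.simps(2) rev_append rev_rev_ident)
    ultimately have "unoriented (rev bs @ [b]) \<in> y \<or> unoriented (b # rev as) \<in> y"
      using that good_break[of "rev bs" b "rev as"] by simp
    then show "unoriented (as @ [b]) \<in> y \<or> unoriented (b # bs) \<in> y"
      using unoriented_rev[of "b # bs"] unoriented_rev[of "as @ [b]"] by (auto simp del: unoriented_rev)
  qed (use good_mem[OF that] in simp)
  have "\<exists>w. unoriented w \<in> x - y"
    using yx biclosed_subset[OF x] by (auto simp: Seg_def)
  then obtain w where w: "unoriented w \<in> x - y" "\<And>v. unoriented v \<in> x - y \<Longrightarrow> length w \<le> length v"
    using ex_has_least_nat[of "\<lambda>w. unoriented w \<in> x - y" _ length] by blast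
  have "good w"
    unfolding good_def
  proof (intro conjI allI impI)
    fix as b bs
    assume ab: "w = as @ b # bs" "as \<noteq> []" "bs \<noteq> []"
    have "unoriented (as @ [b]) \<in> x \<or> unoriented (b # bs) \<in> x"
      using biclosed_break[OF x, of as b bs] w(1) ab by simp
    moreover have "length (as @ [b]) < length w" "length (b # bs) < length w"
      using ab by simp_all
    ultimately show "unoriented (as @ [b]) \<in> y \<or> unoriented (b # bs) \<in> y"
      using w(2)[of "as @ [b]"] w(2)[of "b # bs"] by fastforce
  qed (use w in simp)
  \<comment> \<open>A segment has no more vertices than the tree, so a greatest length
    exists.\<close>
  moreover have "length v < Suc (card (vertices T))" if "good v" for v
  proof -
    have "segment_path T v"
      using good_mem(1)[OF that] mem_Seg_of_biclosed[OF x] by blast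
    then have "distinct v" "set v \<subseteq> vertices T"
      by (auto simp: segment_path_def simple_path_def)
    moreover have "finite (vertices T)"
      using fin by (simp add: plane_tree_def finite_tree_def)
    ultimately show ?thesis
      by (metis card_mono distinct_card le_imp_less_Suc)
  qed
  ultimately obtain v where v: "good v" "\<And>w. good w \<Longrightarrow> length w \<le> length v"
    using ex_has_greatest_nat[of good w length "Suc (card (vertices T))"] by blast
  \<comment> \<open>If composing a longest good segment with a member of \<open>y\<close> led
    outside \<open>y\<close>, then \<open>y\<close> would meet all breaks of the result, which would
    be a longer good segment. The induction on \<open>ys\<close> settles the breaks beyond the joint
    \<open>b\<close>.\<close>
  have ext: "unoriented (xs @ b # ys) \<in> y"
    if "good (xs @ [b])" "length (xs @ [b]) = length v" "ys \<noteq> []" "xs \<noteq> []" "segment_path T (xs @ b # ys)"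
      "unoriented (b # ys) \<in> y" for xs b ys
    using that(3,5,6)
  proof (induction "length ys" arbitrary: ys rule: less_induct)
    case less
    show ?case
    proof (rule ccontr)
      assume out: "unoriented (xs @ b # ys) \<notin> y"
      have "unoriented (xs @ b # ys) \<in> x"
        using biclosed_join[OF x that(4) less.prems(1,2)] good_mem[OF that(1)] less.prems(3) yx by blast
      moreover have "unoriented (as @ [c]) \<in> y \<or> unoriented (c # bs) \<in> y"
        if as: "xs @ b # ys = as @ c # bs" "as \<noteq> []" "bs \<noteq> []" for as c bs
        using as(1)
      proof (cases rule: split_compare)
        case (1 zs)
        then have "unoriented (as @ [c]) \<in> y \<or> unoriented (c # zs @ [b]) \<in> y"
          using good_break[of as c "zs @ [b]"] \<open>good (xs @ [b])\<close> as(2) by simp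
        moreover have "unoriented (c # zs @ b # ys) \<in> y" if "unoriented (c # zs @ [b]) \<in> y"
          using biclosed_join[OF y, of "c # zs" ys b] segment_path_suffix[of T as c zs b ys] that less.prems 1(1)
          by simp
        ultimately show ?thesis
          using 1(2) by auto
      next
        case 2
        then show ?thesis
          using less.prems(3) by simp
      next
        case (3 zs)
        then have "unoriented (b # zs @ [c]) \<in> y \<or> unoriented (c # bs) \<in> y"
          using biclosed_break[OF y, of "b # zs" c bs] less.prems(3) as(3) by simp
        moreover have "unoriented (xs @ b # zs @ [c]) \<in> y" if "unoriented (b # zs @ [c]) \<in> y"
          using less.hyps[of "zs @ [c]"] segment_path_prefix[of T xs b zs c bs] that less.prems(2) as(3) 3(2)
          by simp
        ultimately show ?thesis
          using 3(1) by auto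
      qed
      ultimately have "good (xs @ b # ys)"
        using out unfolding good_def by blast
      from v(2)[OF this] show False
        using that(2) less.prems(1) by (cases ys) auto
    qed
  qed
  have good_eq: "good w \<and> length w = length v" if "unoriented w = unoriented v" for w
    using that v(1) good_rev by (auto simp: unoriented_eq_iff)
  have "biclosed T (insert (unoriented v) y)"
    unfolding biclosed_iff
  proof (intro conjI allI impI)
    show "insert (unoriented v) y \<subseteq> Seg T"
      using good_mem(1)[OF v(1)] biclosed_subset[OF x] yx by blast
  next
    fix xs b ys
    assume ne: "xs \<noteq> []" "ys \<noteq> []" and seg: "segment_path T (xs @ b # ys)"
      and *: "unoriented (xs @ [b]) \<in> insert (unoriented v) y" "unoriented (b # ys) \<in> insert (unoriented v) y"
    have neq: "unoriented (xs @ [b]) \<noteq> unoriented (b # ys)"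
      using breaks_ends_neq[of xs b ys] segment_path_distinct[OF seg] ne by simp
    consider "unoriented (xs @ [b]) \<in> y" "unoriented (b # ys) \<in> y"
      | "unoriented (xs @ [b]) = unoriented v" "unoriented (b # ys) \<in> y"
      | "unoriented (xs @ [b]) \<in> y" "unoriented (b # ys) = unoriented v"
      using * neq by auto
    then have "unoriented (xs @ b # ys) \<in> y"
    proof cases
      case 1
      then show ?thesis
        using biclosed_join[OF y ne seg] by blast
    next
      case 2
      then show ?thesis
        using ext[of xs b ys] good_eq[of "xs @ [b]"] ne seg by simp
    next
      case 3
      have rev: "unoriented (rev ys @ [b]) = unoriented (b # ys)" "unoriented (b # rev xs) = unoriented (xs @ [b])"
        "unoriented (rev ys @ b # rev xs) = unoriented (xs @ b # ys)"
        using unoriented_rev[of "b # ys"] unoriented_rev[of "xs @ [b]"] unoriented_rev[of "xs @ b # ys"]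
        by (simp_all del: unoriented_rev)
      have "segment_path T (rev ys @ b # rev xs)"
        using segment_path_rev[OF seg] by simp
      then show ?thesis
        using ext[of "rev ys" b "rev xs"] good_eq[of "rev ys @ [b]"] ne 3 rev by simp
    qed
    then show "unoriented (xs @ b # ys) \<in> insert (unoriented v) y"
      by blast
  next
    fix xs b ys
    assume ne: "xs \<noteq> []" "ys \<noteq> []" and "unoriented (xs @ b # ys) \<in> insert (unoriented v) y"
    then consider "unoriented (xs @ b # ys) = unoriented v" | "unoriented (xs @ b # ys) \<in> y"
      by blast
    then have "unoriented (xs @ [b]) \<in> y \<or> unoriented (b # ys) \<in> y"
    proof cases
      case 1
      then show ?thesis
        using good_break[OF _ ne] good_eq by blast
    next
      case 2
      then show ?thesis
        using biclosed_break[OF y _ ne] by blast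
    qed
    then show "unoriented (xs @ [b]) \<in> insert (unoriented v) y \<or> unoriented (b # ys) \<in> insert (unoriented v) y"
      by blast
  qed
  then show ?thesis
    using good_mem[OF v(1)] by blast
qed

text \<open>Complementation preserves biclosedness and reverses inclusion, so this is the insertion
  lemma for the complements.\<close>

lemma biclosed_remove_exists:
  assumes "plane_tree T" "biclosed T y" "biclosed T x" "y \<subset> x"
  shows "\<exists>u \<in> x - y. biclosed T (x - {u})"
proof -
  have sub: "x \<subseteq> Seg T"
    using assms(3) by (rule biclosed_subset)
  then obtain u where u: "u \<in> (Seg T - y) - (Seg T - x)" "biclosed T (insert u (Seg T - x))"
    using biclosed_insert_exists[OF assms(1), of "Seg T - x" "Seg T - y"] biclosed_complement assms(2-4) by blast
  have "Seg T - insert u (Seg T - x) = x - {u}"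
    using sub by blast
  then have "biclosed T (x - {u})"
    using biclosed_complement[OF u(2)] by simp
  then show ?thesis
    using u(1) by blast
qed

text \<open>
  If a vertex \<open>b\<close> of a concatenation is not a joint, then it lies inside one part, which is broken by \<open>b\<close>;
  the last alternative is that the part containing \<open>b\<close> is the first one.
\<close>

lemma concat_path_break_cases:
  assumes "\<And>B. B \<in> F \<Longrightarrow> biclosed T B"
  shows "\<lbrakk>concat_path T (\<Union>F) q; q = as @ b # bs; as \<noteq> []; bs \<noteq> []\<rbrakk> \<Longrightarrow>
    concat_path T (\<Union>F) (b # bs) \<or>
    (\<exists>cs c ds. as @ [b] = cs @ c # ds \<and> cs \<noteq> [] \<and> ds \<noteq> [] \<and>
       concat_path T (\<Union>F) (cs @ [c]) \<and> concat_path T (\<Union>F) (c # ds)) \<or>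
    (\<exists>B \<in> F. \<exists>bs'. bs' \<noteq> [] \<and> unoriented (as @ [b]) \<in> B \<and> unoriented (as @ b # bs') \<in> B)"
proof (induction arbitrary: as b bs rule: concat_path.induct)
  case (base q)
  then obtain B where B: "B \<in> F" "unoriented (as @ b # bs) \<in> B"
    by blast
  then have "unoriented (as @ [b]) \<in> B \<or> unoriented (b # bs) \<in> B"
    using biclosed_break[OF assms] base.prems by blast
  moreover have "concat_path T (\<Union>F) (b # bs)" if "unoriented (b # bs) \<in> B"
    using that B segment_path_pieces(2)[of T as b bs] base by (auto intro: concat_path.base)
  ultimately show ?case
    using B base.prems(3) by blast
next
  case (comp xs ys c)
  from comp.prems(1) show ?case
  proof (cases rule: split_compare)
    case (1 zs)
    have IH: "concat_path T (\<Union>F) (b # zs @ [c]) \<or>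
      (\<exists>cs c ds. as @ [b] = cs @ c # ds \<and> cs \<noteq> [] \<and> ds \<noteq> [] \<and>
         concat_path T (\<Union>F) (cs @ [c]) \<and> concat_path T (\<Union>F) (c # ds)) \<or>
      (\<exists>B \<in> F. \<exists>bs'. bs' \<noteq> [] \<and> unoriented (as @ [b]) \<in> B \<and> unoriented (as @ b # bs') \<in> B)"
      using comp.IH(1)[of as b "zs @ [c]"] comp.prems(2) 1(1) by simp
    moreover have "concat_path T (\<Union>F) (b # zs @ c # ys)" if "concat_path T (\<Union>F) (b # zs @ [c])"
      using concat_path.comp[of "b # zs" ys T c "\<Union>F"] segment_path_suffix[of T as b zs c ys] that comp.hyps(2,3,5) 1(1)
      by simp
    ultimately show ?thesis
      unfolding 1(2) by blast
  next
    case 2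
    then show ?thesis
      using comp.hyps(5) by simp
  next
    case (3 zs)
    \<comment> \<open>The joint \<open>c\<close> precedes \<open>b\<close>, so the second
      alternative holds as soon as the stretch from \<open>c\<close> to \<open>b\<close> is a
      concatenation.\<close>
    have dec: ?thesis if "concat_path T (\<Union>F) (c # zs @ [b])"
    proof -
      have "as @ [b] = xs @ c # (zs @ [b])"
        using 3(1) by simp
      then show ?thesis
        using that comp.hyps(1,4) by blast
    qed
    have "concat_path T (\<Union>F) (b # bs) \<or>
      (\<exists>cs d ds. c # zs @ [b] = cs @ d # ds \<and> cs \<noteq> [] \<and> ds \<noteq> [] \<and>
         concat_path T (\<Union>F) (cs @ [d]) \<and> concat_path T (\<Union>F) (d # ds)) \<or>
      (\<exists>B \<in> F. \<exists>bs'. bs' \<noteq> [] \<and> unoriented (c # zs @ [b]) \<in> B \<and> unoriented (c # zs @ b # bs') \<in> B)"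
      using comp.IH(2)[of "c # zs" b bs] comp.prems(3) 3(2) by simp
    moreover have seg: "segment_path T (c # zs @ [b])"
      using segment_path_infix[of T xs "c # zs @ [b]" bs] comp.hyps(3) 3(2) by simp
    ultimately consider "concat_path T (\<Union>F) (b # bs)" | "concat_path T (\<Union>F) (c # zs @ [b])"
      using concat_path.comp concat_path.base by (metis UnionI)
    then show ?thesis
      using dec by cases blast+
  qed
qed

text \<open>The hypothesis on \<open>S\<close> says that a single segment of \<open>S\<close> from
  the start or a low joint to a high joint or the end is all of \<open>p\<close>; the local claim
  \<open>*\<close> extends this to concatenations. As \<open>b\<close> is low or high, it applies to
  the half after or before \<open>b\<close>, which is not all of \<open>p\<close>.\<close>

lemma not_decomposable:
  assumes sc: "split_choice T p D"
    and S: "\<And>xs q ys. \<lbrakk>p = xs @ q @ ys; unoriented q \<in> S; xs \<noteq> [] \<Longrightarrow> unoriented (xs @ [hd q]) \<in> D;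
      ys \<noteq> [] \<Longrightarrow> unoriented (last q # ys) \<in> D\<rbrakk> \<Longrightarrow> xs = [] \<and> ys = []"
    and p: "p = as @ b # bs" "as \<noteq> []" "bs \<noteq> []"
    and parts: "concat_path T S (as @ [b])" "concat_path T S (b # bs)"
  shows False
proof -
  have *: "\<lbrakk>concat_path T S q; p = xs @ q @ ys; xs \<noteq> [] \<Longrightarrow> unoriented (xs @ [hd q]) \<in> D;
      ys \<noteq> [] \<Longrightarrow> unoriented (last q # ys) \<in> D\<rbrakk> \<Longrightarrow> xs = [] \<and> ys = []" for q xs ys
  proof (induction arbitrary: xs ys rule: concat_path.induct)
    case (base q)
    then show ?case
      using S by blast
  next
    case (comp as bs b)
    have p: "p = (xs @ as) @ b # (bs @ ys)"
      using comp.prems(1) by simp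
    show ?case
    \<comment> \<open>A low joint can start the second half and a high joint can end the first, so
      one half inherits both boundary conditions; the induction hypothesis then contradicts that the
      other half is nonempty.\<close>
    proof (cases "unoriented ((xs @ as) @ [b]) \<in> D")
      case True
      then show ?thesis
        using comp.IH(2)[of "xs @ as" ys] p comp.prems(3) comp.hyps(1,2) by simp
    next
      case False
      then have "unoriented (b # bs @ ys) \<in> D"
        using split_choice_break[OF sc p] comp.hyps(1,2) by simp
      then show ?thesis
        using comp.IH(1)[of xs "bs @ ys"] p comp.prems(2) comp.hyps(1,2) by simp
    qed
  qed
  show False
    using *[OF parts(2), of as "[]"] *[OF parts(1), of "[]" bs] split_choice_break[OF sc p] p by auto
qed

section \<open>Canonical join representations\<close>

text \<open>For closedness, \<open>not_decomposable\<close> reduces any decomposition to one with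
  parts from two of the sets, which \<open>comp\<close> excludes. The hypothesis \<open>sub\<close>
  enters for segments of the join that extend \<open>p i\<close>.\<close>

lemma biclosed_Union_remove:
  fixes p :: "'i \<Rightarrow> 'v list" and D :: "'i \<Rightarrow> 'v list set set"
  assumes sc: "\<And>j. j \<in> I \<Longrightarrow> split_choice T (p j) (D j)" and i: "i \<in> I"
    and comp: "\<And>j ts. \<lbrakk>j \<in> I; j \<noteq> i; 2 \<le> length ts; set ts \<subseteq> J_pieces (p i) (D i) \<union> J_pieces (p j) (D j)\<rbrakk> \<Longrightarrow>
      \<not> is_composition T ts (unoriented (p i))"
    and sub: "\<And>j. \<lbrakk>j \<in> I; j \<noteq> i\<rbrakk> \<Longrightarrow> \<not> J_pieces (p i) (D i) \<subseteq> J_pieces (p j) (D j)"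
  defines "F \<equiv> (\<lambda>j. J_pieces (p j) (D j)) ` I"
  shows "biclosed T (concat_closure T (\<Union>F) - {unoriented (p i)})"
proof -
  have F: "biclosed T B" if "B \<in> F" for B
    using that sc biclosed_J_pieces unfolding F_def by blast
  have DJ: "D i \<subseteq> J_pieces (p i) (D i)"
    using J_pieces_inter_splits[OF sc[OF i]] by blast
  have nd: False
    if r: "unoriented r = unoriented (p i)" "r = as @ b # bs" "as \<noteq> []" "bs \<noteq> []"
      and parts: "concat_path T (\<Union>F) (as @ [b])" "concat_path T (\<Union>F) (b # bs)" for r as b bs
  proof -
    have "r = p i \<or> r = rev (p i)"
      using r(1) by (simp add: unoriented_eq_iff)
    then have scr: "split_choice T r (D i)" and Jr: "J_pieces r (D i) = J_pieces (p i) (D i)"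
      using sc[OF i] split_choice_rev by auto
    have segr: "segment_path T r"
      using split_choice_path[OF scr] .
    have "xs = [] \<and> ys = []"
      if q: "r = xs @ q @ ys" "unoriented q \<in> \<Union>F" and xs: "xs \<noteq> [] \<Longrightarrow> unoriented (xs @ [hd q]) \<in> D i"
        and ys: "ys \<noteq> [] \<Longrightarrow> unoriented (last q # ys) \<in> D i" for xs q ys
    proof -
      obtain j where j: "j \<in> I" "unoriented q \<in> J_pieces (p j) (D j)"
        using q(2) unfolding F_def by blast
      have "segment_path T q"
        using mem_Seg_of_biclosed[OF biclosed_J_pieces[OF sc[OF j(1)]] j(2)] .
      then have len: "2 \<le> length q"
        by (rule segment_path_length)
      obtain c cs where c: "q = c # cs" "cs \<noteq> []"
        using len Cons_of_length_ge_2 by blast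
      obtain ds d where d: "q = ds @ [d]" "ds \<noteq> []"
        using len snoc_of_length_ge_2 by blast
      have xc: "unoriented (xs @ [c]) \<in> D i" if "xs \<noteq> []"
        using xs[OF that] c(1) by simp
      have dy: "unoriented (d # ys) \<in> D i" if "ys \<noteq> []"
        using ys[OF that] d(1) by simp
      show ?thesis
      \<comment> \<open>If \<open>j = i\<close>, then \<open>q\<close> and a nonempty flank in
        \<open>D i\<close> would be joinable members of one set of pieces.\<close>
      proof (cases "j = i")
        case True
        have "xs = []"
        proof (rule ccontr)
          assume "xs \<noteq> []"
          moreover have "distinct (xs @ c # cs)"
            using segment_path_distinct[OF segr] q(1) c(1) by auto
          ultimately show False
            using J_pieces_not_joinable[OF sc[OF i], of xs c cs] xc c j(2) True DJ by auto
        qed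
        moreover have "ys = []"
        proof (rule ccontr)
          assume "ys \<noteq> []"
          moreover have "distinct (ds @ d # ys)"
            using segment_path_distinct[OF segr] q(1) d(1) by auto
          ultimately show False
            using J_pieces_not_joinable[OF sc[OF i], of ds d ys] dy d j(2) True DJ by auto
        qed
        ultimately show ?thesis
          by blast
      next
        case False
        \<comment> \<open>For \<open>j\<close> other than \<open>i\<close>, the piece
          \<open>q\<close> and its nonempty flanks, which lie in \<open>D i\<close>, compose to
          \<open>p i\<close>, against \<open>comp\<close>.\<close>
        show ?thesis
        proof (rule ccontr)
          assume "\<not> (xs = [] \<and> ys = [])"
          then consider "xs \<noteq> []" "ys \<noteq> []" | "xs \<noteq> []" "ys = []" | "xs = []" "ys \<noteq> []"
            by blast
          then show False
          proof cases
            case 1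
            obtain es where es: "cs = es @ [d]"
              using c d by (metis append_butlast_last_id last_ConsR last_snoc)
            have "is_composition T [unoriented (xs @ [c]), unoriented q, unoriented (d # ys)] (unoriented (p i))"
              using is_composition_three[of T xs c es d ys] segr q(1) 1 c(1) es r(1) by simp
            then show False
              using comp[OF j(1) False, of "[unoriented (xs @ [c]), unoriented q, unoriented (d # ys)]"]
                xc dy 1 j(2) DJ by auto
          next
            case 2
            have "is_composition T [unoriented (xs @ [c]), unoriented q] (unoriented (p i))"
              using is_composition_two[of T xs c cs] segr q(1) 2 c r(1) by simp
            then show False
              using comp[OF j(1) False, of "[unoriented (xs @ [c]), unoriented q]"] xc 2 j(2) DJ by auto
          next
            case 3
            have "is_composition T [unoriented q, unoriented (d # ys)] (unoriented (p i))"
              using is_composition_two[of T ds d ys] segr q(1) 3 d r(1) by simp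
            then show False
              using comp[OF j(1) False, of "[unoriented q, unoriented (d # ys)]"] dy 3 j(2) DJ by auto
          qed
        qed
      qed
    qed
    then show False
      by (rule not_decomposable[OF scr _ r(2-4) parts])
  qed
  show ?thesis
    using biclosed_concat_closure[OF F]
  proof (rule biclosed_remove)
    fix xs b ys
    assume "p i = xs @ b # ys" "xs \<noteq> []" "ys \<noteq> []" "unoriented (xs @ [b]) \<in> concat_closure T (\<Union>F)"
      "unoriented (b # ys) \<in> concat_closure T (\<Union>F)"
    then show False
      using nd[of "p i" xs b ys] by simp
  next
    fix as b bs
    assume r: "unoriented (as @ [b]) = unoriented (p i)" "bs \<noteq> []" and "unoriented (as @ b # bs) \<in> concat_closure T (\<Union>F)"
    then have cp: "concat_path T (\<Union>F) (as @ b # bs)"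
      by simp
    have "as @ [b] = p i \<or> as @ [b] = rev (p i)"
      using r(1) by (simp add: unoriented_eq_iff)
    then have scr: "split_choice T (as @ [b]) (D i)"
      using sc[OF i] split_choice_rev by auto
    have ne: "as \<noteq> []"
      using segment_path_length[OF split_choice_path[OF scr]] by auto
    \<comment> \<open>The set \<open>B\<close> contains a segment longer than \<open>p i\<close>, so
      it is not the one of \<open>i\<close>. As it does not include the set of \<open>i\<close>,
      minimality yields a split of \<open>p i\<close> in \<open>B\<close> outside
      \<open>D i\<close>. With the opposite split, which is in \<open>D i\<close>, it composes to
      \<open>p i\<close>, against \<open>comp\<close>.\<close>
    have "\<not> (\<exists>B \<in> F. \<exists>bs'. bs' \<noteq> [] \<and> unoriented (as @ [b]) \<in> B \<and> unoriented (as @ b # bs') \<in> B)"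
    proof
      assume "\<exists>B \<in> F. \<exists>bs'. bs' \<noteq> [] \<and> unoriented (as @ [b]) \<in> B \<and> unoriented (as @ b # bs') \<in> B"
      then obtain j bs' where j: "j \<in> I" "bs' \<noteq> []" "unoriented (as @ [b]) \<in> J_pieces (p j) (D j)"
          "unoriented (as @ b # bs') \<in> J_pieces (p j) (D j)"
        unfolding F_def by blast
      have "j \<noteq> i"
        using J_pieces_length_le[OF j(4)] unoriented_eq_length[OF r(1)] j(2) by (cases bs') auto
      have Jj: "biclosed T (J_pieces (p j) (D j))"
        using biclosed_J_pieces[OF sc[OF j(1)]] .
      have "\<not> J_pieces (p j) (D j) \<inter> splits T (unoriented (p i)) \<subseteq> D i"
        using J_pieces_least[OF sc[OF i] Jj] sub[OF j(1) \<open>j \<noteq> i\<close>] j(3) r(1) by auto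
      then obtain d where d: "d \<in> J_pieces (p j) (D j)" "d \<in> splits T (unoriented (p i))" "d \<notin> D i"
        by blast
      obtain xs c ys where xs: "p i = xs @ c # ys" "xs \<noteq> []" "ys \<noteq> []"
          and cs: "d = unoriented (xs @ [c]) \<or> d = unoriented (c # ys)"
        using d(2) unfolding splits_unoriented[OF split_choice_path[OF sc[OF i]]] by blast
      have "{unoriented (xs @ [c]), unoriented (c # ys)} \<subseteq> J_pieces (p i) (D i) \<union> J_pieces (p j) (D j)"
        using split_choice_break[OF sc[OF i] xs] cs d DJ by auto
      moreover have "is_composition T [unoriented (xs @ [c]), unoriented (c # ys)] (unoriented (p i))"
        using is_composition_two[of T xs c ys] xs split_choice_path[OF sc[OF i]] by simp
      ultimately show False
        using comp[OF j(1) \<open>j \<noteq> i\<close>, of "[unoriented (xs @ [c]), unoriented (c # ys)]"] by simp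
    qed
    moreover have "\<not> (\<exists>cs c ds. as @ [b] = cs @ c # ds \<and> cs \<noteq> [] \<and> ds \<noteq> [] \<and>
       concat_path T (\<Union>F) (cs @ [c]) \<and> concat_path T (\<Union>F) (c # ds))"
      using nd[OF r(1)] by blast
    ultimately show "unoriented (b # bs) \<in> concat_closure T (\<Union>F)"
      using concat_path_break_cases[OF F cp refl ne r(2)] by auto
  qed
qed

section \<open>Labels of removable segments\<close>

text \<open>A split of \<open>p\<close> in \<open>x\<close> outside \<open>D\<close> would have its
  opposite in \<open>D\<close>, hence in \<open>x\<close>. Both are shorter than \<open>p\<close>,
  so closedness of \<open>x - {unoriented p}\<close> would force \<open>p\<close> back in.\<close>

lemma inter_splits_of_removable:
  assumes sc: "split_choice T p D" and x: "biclosed T (x - {unoriented p})" and sub: "J_pieces p D \<subseteq> x"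
  shows "x \<inter> splits T (unoriented p) \<subseteq> D"
proof
  fix d assume d: "d \<in> x \<inter> splits T (unoriented p)"
  then obtain xs b ys where p: "p = xs @ b # ys" "xs \<noteq> []" "ys \<noteq> []"
      and cs: "d = unoriented (xs @ [b]) \<or> d = unoriented (b # ys)"
    unfolding splits_unoriented[OF split_choice_path[OF sc]] by blast
  have neq: "unoriented (xs @ [b]) \<noteq> unoriented p" "unoriented (b # ys) \<noteq> unoriented p"
    using p by (auto dest: unoriented_eq_length)
  show "d \<in> D"
  proof (rule ccontr)
    assume "d \<notin> D"
    then have "unoriented (xs @ [b]) \<in> x" "unoriented (b # ys) \<in> x"
      using split_choice_break[OF sc p] J_pieces_inter_splits[OF sc] sub cs d by blast+
    then have "unoriented p \<in> x - {unoriented p}"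
      using biclosed_join[OF x p(2,3)] split_choice_path[OF sc] neq p(1) by auto
    then show False
      by blast
  qed
qed

lemma J_pieces_subset_of_removable:
  assumes sc: "split_choice T p D" and x: "biclosed T (x - {unoriented p})" and sub: "J_pieces p D \<subseteq> x"
    and b: "biclosed T b" "b \<subseteq> x" "unoriented p \<in> b"
  shows "J_pieces p D \<subseteq> b"
  using J_pieces_least[OF sc b(1,3)] inter_splits_of_removable[OF sc x sub] b(2) by blast

text \<open>From each break of \<open>p\<close>, the set \<open>x\<close> has at least one piece
  because it is biclosed, and at most one because it is closed without \<open>p\<close>. Every
  removable segment thus receives a label.\<close>

lemma split_choice_of_removable:
  assumes p: "segment_path T p" "unoriented p \<in> x" and x: "biclosed T x" "biclosed T (x - {unoriented p})"
  shows "split_choice T p (x \<inter> splits T (unoriented p))"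
  unfolding split_choice_def
proof (intro conjI allI impI)
  fix xs b ys
  assume split: "p = xs @ b # ys" "xs \<noteq> []" "ys \<noteq> []"
  have "unoriented (xs @ [b]) \<in> splits T (unoriented p)" "unoriented (b # ys) \<in> splits T (unoriented p)"
    using split unfolding splits_unoriented[OF p(1)] by blast+
  moreover have "unoriented (xs @ [b]) \<noteq> unoriented p" "unoriented (b # ys) \<noteq> unoriented p"
    using split by (auto dest: unoriented_eq_length)
  then have "\<not> (unoriented (xs @ [b]) \<in> x \<and> unoriented (b # ys) \<in> x)"
    using biclosed_join[OF x(2) split(2,3), of b] p(1) split(1) by auto
  moreover have "unoriented (xs @ [b]) \<in> x \<or> unoriented (b # ys) \<in> x"
    using biclosed_break[OF x(1) _ split(2,3)] p(2) split(1) by simp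
  ultimately show "unoriented (xs @ [b]) \<in> x \<inter> splits T (unoriented p) \<longleftrightarrow>
      unoriented (b # ys) \<notin> x \<inter> splits T (unoriented p)"
    by blast
qed (use p in auto)

lemma irredundant_join_antichain:
  assumes "irredundant_join (Bic T) A" "a \<in> A" "b \<in> A" "a \<subseteq> b"
  shows "a = b"
proof (rule ccontr)
  assume "a \<noteq> b"
  have A: "biclosed T B" if "B \<in> A" for B
    using assms(1) that by (auto simp: irredundant_join_def)
  have "\<Union>(A - {a}) = \<Union>A"
    using assms(2-4) \<open>a \<noteq> b\<close> by blast
  then have "\<Squnion>\<^bsub>Bic T\<^esub>(A - {a}) = \<Squnion>\<^bsub>Bic T\<^esub>A"
    using sup_Bic[of "A - {a}" T] sup_Bic[of A T] A by simp
  then show False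
    using assms(1,2) by (auto simp: irredundant_join_def)
qed

section \<open>Necessity: canonical joinands come from removable segments\<close>

text \<open>The candidates in \<open>C\<close> are the sets of pieces of all removable segments of
  \<open>x\<close>. They join to \<open>x\<close>, so \<open>A\<close> refines an irredundant
  subfamily of them; minimality and the antichain property of \<open>A\<close> then identify
  \<open>J_pieces p D\<close> with a candidate.\<close>

lemma biclosed_remove_of_canonical:
  assumes fin: "plane_tree T" and can: "canonical_join_representation (Bic T) x A"
    and sc: "split_choice T p D" and pA: "J_pieces p D \<in> A"
  shows "biclosed T (x - {unoriented p})"
proof -
  have irr: "irredundant_join (Bic T) A" and xA: "x = \<Squnion>\<^bsub>Bic T\<^esub>A"
    using can by (auto simp: canonical_join_representation_def)
  have A: "biclosed T B" if "B \<in> A" for B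
    using irr that by (auto simp: irredundant_join_def)
  have x: "biclosed T x"
    using biclosed_sup_Bic[of A T] A xA by simp
  define C where "C = {J_pieces q (x \<inter> splits T (unoriented q)) | q. unoriented q \<in> x \<and> biclosed T (x - {unoriented q})}"
  have C: "\<exists>q. B = J_pieces q (x \<inter> splits T (unoriented q)) \<and> unoriented q \<in> x \<and> biclosed T (x - {unoriented q}) \<and>
      split_choice T q (x \<inter> splits T (unoriented q))" if "B \<in> C" for B
    using that split_choice_of_removable[OF _ _ x] mem_Seg_of_biclosed[OF x] unfolding C_def by blast
  have CB: "biclosed T B \<and> B \<subseteq> x" if "B \<in> C" for B
  proof -
    obtain q where q: "B = J_pieces q (x \<inter> splits T (unoriented q))" "unoriented q \<in> x"
      "split_choice T q (x \<inter> splits T (unoriented q))"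
      using C \<open>B \<in> C\<close> by blast
    then show ?thesis
      using biclosed_J_pieces[OF q(3)] J_pieces_least[OF q(3) x] by blast
  qed
  \<comment> \<open>Otherwise a covering step down from \<open>x\<close> towards the join of
    \<open>C\<close> removes a segment \<open>u\<close> outside that join, although the candidate of
    \<open>u\<close> contains \<open>u\<close>.\<close>
  have supC: "\<Squnion>\<^bsub>Bic T\<^esub>C = x"
  proof (rule ccontr)
    assume "\<Squnion>\<^bsub>Bic T\<^esub>C \<noteq> x"
    moreover have "\<Squnion>\<^bsub>Bic T\<^esub>C \<subseteq> x"
      using sup_Bic_least[OF x] CB by blast
    ultimately obtain u where u: "u \<in> x" "u \<notin> \<Squnion>\<^bsub>Bic T\<^esub>C" "biclosed T (x - {u})"
      using biclosed_remove_exists[OF fin biclosed_sup_Bic x] CB by blast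
    then obtain q where q: "u = unoriented q" "segment_path T q"
      using biclosed_subset[OF x] by (blast elim: Seg_cases)
    then have "J_pieces q (x \<inter> splits T (unoriented q)) \<in> C"
      using u unfolding C_def by blast
    then have "J_pieces q (x \<inter> splits T (unoriented q)) \<subseteq> \<Squnion>\<^bsub>Bic T\<^esub>C"
      using sup_Bic_upper[of C T] CB by blast
    then show False
      using self_in_J_pieces[OF q(2)] u(2) q(1) by blast
  qed
  have "C \<subseteq> Pow (Seg T)"
    using CB biclosed_subset by blast
  then have "finite C"
    using finite_Seg[OF fin] by (simp add: finite_subset)
  \<comment> \<open>Canonicity compares \<open>A\<close> with irredundant joins only; a minimal
    subfamily of \<open>C\<close> with join \<open>x\<close> is one.\<close>
  define \<C> where "\<C> = {C'. C' \<subseteq> C \<and> \<Squnion>\<^bsub>Bic T\<^esub>C' = x}"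
  have "finite \<C>" "C \<in> \<C>"
    using \<open>finite C\<close> supC by (simp_all add: \<C>_def)
  then obtain C' where "C' \<in> \<C>" and min: "\<And>C''. C'' \<in> \<C> \<Longrightarrow> C'' \<subseteq> C' \<Longrightarrow> C' = C''"
    using finite_has_minimal[of \<C>] by (metis empty_iff)
  then have C': "C' \<subseteq> C" "\<Squnion>\<^bsub>Bic T\<^esub>C' = x"
    by (simp_all add: \<C>_def)
  have "irredundant_join (Bic T) C'"
    unfolding irredundant_join_def
  proof (intro conjI allI impI notI)
    fix C'' assume "C'' \<subset> C'" "\<Squnion>\<^bsub>Bic T\<^esub>C'' = \<Squnion>\<^bsub>Bic T\<^esub>C'"
    then show False
      using min[of C''] C' by (auto simp: \<C>_def)
  next
    show "C' \<subseteq> carrier (Bic T)"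
      using C'(1) CB by auto
  qed
  moreover have "C' \<subseteq> JI (Bic T)"
    using C C'(1) J_pieces_in_JI by blast
  ultimately have "join_refines (Bic T) A C'"
    using can C'(2) unfolding canonical_join_representation_def by blast
  then obtain B where B: "B \<in> C" "J_pieces p D \<subseteq> B"
    using pA C'(1) unfolding join_refines_def le_Bic by blast
  then obtain q where q: "B = J_pieces q (x \<inter> splits T (unoriented q))" "unoriented q \<in> x"
      "biclosed T (x - {unoriented q})" "split_choice T q (x \<inter> splits T (unoriented q))"
    using C by blast
  have "\<exists>a \<in> A. unoriented q \<in> a"
  proof (rule ccontr)
    assume "\<not> (\<exists>a \<in> A. unoriented q \<in> a)"
    then have "\<Squnion>\<^bsub>Bic T\<^esub>A \<subseteq> x - {unoriented q}"
      using A sup_Bic_upper[of A T] xA by (intro sup_Bic_least[OF q(3)]) blast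
    then show False
      using q(2) xA by blast
  qed
  then obtain a where a: "a \<in> A" "unoriented q \<in> a"
    by blast
  have "a \<subseteq> x"
    using sup_Bic_upper[of A T] A a(1) xA by blast
  \<comment> \<open>\<open>B\<close> is the least biclosed subset of \<open>x\<close> containing
    \<open>q\<close>. So \<open>J_pieces p D\<close>, \<open>B\<close> and \<open>a\<close> form a
    chain whose ends are in \<open>A\<close>, and all three are equal.\<close>
  then have "B \<subseteq> a"
    using J_pieces_subset_of_removable[OF q(4,3) _ A[OF a(1)] _ a(2)] CB[OF B(1)] q(1) by blast
  then have "J_pieces p D = B"
    using irredundant_join_antichain[OF irr pA a(1)] B(2) by blast
  then have "unoriented p = unoriented q"
    using J_pieces_inject(1)[OF sc q(4)] q(1) by simp
  then show ?thesis
    using q(3) by simp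
qed

text \<open>All parts but the first compose inside \<open>x\<close> to a final piece. It and the
  first part are shorter than \<open>s\<close>, so they lie in \<open>x - {s}\<close>, whose
  closedness would give \<open>s\<close> as well.\<close>

lemma composition_not_removable:
  assumes x: "biclosed T x" "biclosed T (x - {s})"
    and ts: "is_composition T ts s" "2 \<le> length ts" "set ts \<subseteq> x"
  shows False
proof -
  obtain ps where ps: "ts = map unoriented ps" "successively (\<lambda>p q. last p = hd q) ps"
      "s = unoriented (hd ps @ concat (map tl (tl ps)))" and s: "s \<in> Seg T"
    using ts(1) unfolding is_composition_def by blast
  obtain p q qs where pq: "ps = p # q # qs"
    using ts(2) ps(1) by (cases ps; cases "tl ps") auto
  have mem: "unoriented p \<in> x" "unoriented q \<in> x" "unoriented ` set (q # qs) \<subseteq> x"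
    using ts(3) ps(1) pq by auto
  have "2 \<le> length p" "2 \<le> length q"
    using mem mem_Seg_of_biclosed[OF x(1)] segment_path_length by blast+
  then obtain as b c cs where p: "p = as @ [b]" "as \<noteq> []" and "q = c # cs" "cs \<noteq> []"
    using snoc_of_length_ge_2[of p] Cons_of_length_ge_2[of q] by metis
  then have q: "q = b # cs" "cs \<noteq> []"
    using ps(2) pq by auto
  define bs where "bs = cs @ concat (map tl qs)"
  have s_eq: "s = unoriented (as @ b # bs)" and seg: "segment_path T (as @ b # bs)" and bs: "bs \<noteq> []"
    using ps(3) pq p q s by (auto simp: bs_def)
  have "unoriented (hd (q # qs) @ concat (map tl (tl (q # qs)))) \<in> x"
  proof (rule is_composition_closed)
    show "closed_segments T x"
      using x(1) by (simp add: biclosed_def)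
    show "segment_path T (hd (q # qs) @ concat (map tl (tl (q # qs))))"
      using segment_path_pieces(2)[OF seg bs] by (simp add: q bs_def)
  qed (use ps(2) pq mem in auto)
  then have "unoriented (b # bs) \<in> x"
    by (simp add: q bs_def)
  moreover have "unoriented (as @ [b]) \<in> x"
    using mem(1) p by simp
  moreover have "unoriented (b # bs) \<noteq> s" "unoriented (as @ [b]) \<noteq> s"
    using p(2) bs unfolding s_eq by (auto dest: unoriented_eq_length)
  ultimately have "s \<in> x - {s}"
    unfolding s_eq using biclosed_join[OF x(2) p(2) bs seg] s_eq by blast
  then show False
    by blast
qed

section \<open>The faces of the canonical join complex\<close>

theorem theorem4p1:
  fixes T :: "'v plane_graph"
    and k :: nat
    and s :: "nat \<Rightarrow> 'v list set"
    and D :: "nat \<Rightarrow> 'v list set set"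
  assumes "plane_tree T"
    and "\<And>i. i \<in> {1..k} \<Longrightarrow> (s i, D i) \<in> labels T"
    and "inj_on (\<lambda>i. (s i, D i)) {1..k}"
  shows "{J T (s i, D i) | i. i \<in> {1..k}} \<in> canonical_join_complex (Bic T) \<longleftrightarrow>
    (\<forall>i \<in> {1..k}. \<forall>j \<in> {1..k}. i \<noteq> j \<longrightarrow>
       s i \<noteq> s j \<and>
       (\<nexists>ts. length ts \<ge> 2 \<and> set ts \<subseteq> J T (s i, D i) \<union> J T (s j, D j) \<and>
          (is_composition T ts (s i) \<or> is_composition T ts (s j))) \<and>
       \<not> J T (s i, D i) \<subseteq> J T (s j, D j) \<and> \<not> J T (s j, D j) \<subseteq> J T (s i, D i))"
    (is "?F \<in> _ \<longleftrightarrow> ?R")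
proof -
  have "\<exists>q. s i = unoriented q" if "i \<in> {1..k}" for i
    using assms(2)[OF that] by (auto simp: labels_def Seg_def)
  then obtain p where p: "\<And>i. i \<in> {1..k} \<Longrightarrow> s i = unoriented (p i)"
    by metis
  have sc: "split_choice T (p i) (D i)" if "i \<in> {1..k}" for i
    using labels_split_choice[OF assms(1)] assms(2)[OF that] p[OF that] by simp
  have J: "J T (s i, D i) = J_pieces (p i) (D i)" if "i \<in> {1..k}" for i
    using J_eq_pieces[OF sc[OF that]] p[OF that] by simp
  define F where "F = (\<lambda>i. J_pieces (p i) (D i)) ` {1..k}"
  have F_eq: "?F = F"
  proof -
    have "?F = (\<lambda>i. J T (s i, D i)) ` {1..k}"
      by blast
    then show ?thesis
      using image_cong[OF refl J, of "{1..k}"] unfolding F_def by simp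
  qed
  have F: "biclosed T B" if "B \<in> F" for B
    using that sc biclosed_J_pieces unfolding F_def by blast
  have memF: "J_pieces (p i) (D i) \<in> F" if "i \<in> {1..k}" for i
    using that unfolding F_def by blast
  show ?thesis
    unfolding F_eq
  proof
    assume "F \<in> canonical_join_complex (Bic T)"
    then obtain x where can: "canonical_join_representation (Bic T) x F"
      unfolding canonical_join_complex_def by blast
    then have irr: "irredundant_join (Bic T) F" and x_eq: "x = \<Squnion>\<^bsub>Bic T\<^esub>F"
      by (auto simp: canonical_join_representation_def)
    have x: "biclosed T x"
      using biclosed_sup_Bic[of F T] F x_eq by simp
    have up: "J_pieces (p i) (D i) \<subseteq> x" if "i \<in> {1..k}" for i
      using sup_Bic_upper[of F T] F memF[OF that] x_eq by blast
    have rem: "biclosed T (x - {s i})" if "i \<in> {1..k}" for i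
      using biclosed_remove_of_canonical[OF assms(1) can sc memF] that p by simp
    \<comment> \<open>The join determines \<open>D i\<close> from \<open>s i\<close>; by injectivity
      of the labels, different indices then have different segments.\<close>
    have D: "D i = x \<inter> splits T (s i)" if "i \<in> {1..k}" for i
    proof (intro equalityI)
      have "D i \<subseteq> J_pieces (p i) (D i) \<inter> splits T (s i)"
        using J_pieces_inter_splits[OF sc[OF that]] p[OF that] by simp
      then show "D i \<subseteq> x \<inter> splits T (s i)"
        using up[OF that] by blast
      show "x \<inter> splits T (s i) \<subseteq> D i"
        using inter_splits_of_removable[OF sc[OF that] _ up[OF that]] rem[OF that] p[OF that] by simp
    qed
    have inj: "i = j" if "i \<in> {1..k}" "j \<in> {1..k}" "s i = s j" for i j
      using inj_onD[OF assms(3), of i j] D[OF that(1)] D[OF that(2)] that by simp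
    have sub: "\<not> J_pieces (p i) (D i) \<subseteq> J_pieces (p j) (D j)" if "i \<in> {1..k}" "j \<in> {1..k}" "i \<noteq> j" for i j
    proof
      assume "J_pieces (p i) (D i) \<subseteq> J_pieces (p j) (D j)"
      then have "J_pieces (p i) (D i) = J_pieces (p j) (D j)"
        by (rule irredundant_join_antichain[OF irr memF[OF that(1)] memF[OF that(2)]])
      then have "s i = s j"
        using J_pieces_inject(1)[OF sc[OF that(1)] sc[OF that(2)]] p that by simp
      then show False
        using inj[OF that(1,2)] that(3) by blast
    qed
    have comp: "\<not> is_composition T ts (s l)"
      if "i \<in> {1..k}" "j \<in> {1..k}" "l \<in> {1..k}" "2 \<le> length ts" "set ts \<subseteq> J T (s i, D i) \<union> J T (s j, D j)" for ts i j l
    proof -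
      have "set ts \<subseteq> x"
        using up[OF that(1)] up[OF that(2)] J[OF that(1)] J[OF that(2)] that(5) by auto
      then show ?thesis
        using composition_not_removable[OF x rem[OF that(3)] _ that(4)] by blast
    qed
    show ?R
    proof (intro ballI impI conjI)
      fix i j assume ij: "i \<in> {1..k}" "j \<in> {1..k}" "i \<noteq> j"
      show "s i \<noteq> s j"
        using inj[OF ij(1,2)] ij(3) by blast
      show "\<nexists>ts. length ts \<ge> 2 \<and> set ts \<subseteq> J T (s i, D i) \<union> J T (s j, D j) \<and>
          (is_composition T ts (s i) \<or> is_composition T ts (s j))"
        using comp[OF ij(1,2,1)] comp[OF ij(1,2,2)] by blast
      show "\<not> J T (s i, D i) \<subseteq> J T (s j, D j)" "\<not> J T (s j, D j) \<subseteq> J T (s i, D i)"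
        using sub[OF ij] sub[OF ij(2,1)] ij(3) J[OF ij(1)] J[OF ij(2)] by simp_all
    qed
  next
    assume R: ?R
    define x where "x = \<Squnion>\<^bsub>Bic T\<^esub>F"
    have x: "biclosed T x"
      using biclosed_sup_Bic[of F T] F x_def by simp
    have sub: "\<not> J_pieces (p i) (D i) \<subseteq> J_pieces (p j) (D j)" if "i \<in> {1..k}" "j \<in> {1..k}" "i \<noteq> j" for i j
    proof -
      have "\<not> J T (s i, D i) \<subseteq> J T (s j, D j)"
        using R that by blast
      then show ?thesis
        using J[OF that(1)] J[OF that(2)] by simp
    qed
    have comp: "\<not> is_composition T ts (s i)"
      if "i \<in> {1..k}" "j \<in> {1..k}" "i \<noteq> j" "2 \<le> length ts" "set ts \<subseteq> J_pieces (p i) (D i) \<union> J_pieces (p j) (D j)" for ts i j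
    proof -
      have "\<nexists>ts. length ts \<ge> 2 \<and> set ts \<subseteq> J T (s i, D i) \<union> J T (s j, D j) \<and>
          (is_composition T ts (s i) \<or> is_composition T ts (s j))"
        using R that(1-3) by blast
      then show ?thesis
        using that(4,5) J[OF that(1)] J[OF that(2)] by auto
    qed
    have rem: "biclosed T (x - {unoriented (p i)})" if "i \<in> {1..k}" for i
    proof -
      have "biclosed T (concat_closure T (\<Union>((\<lambda>j. J_pieces (p j) (D j)) ` {1..k})) - {unoriented (p i)})"
      proof (rule biclosed_Union_remove[OF sc that])
        fix j ts
        assume "j \<in> {1..k}" "j \<noteq> i" "2 \<le> length ts" "set ts \<subseteq> J_pieces (p i) (D i) \<union> J_pieces (p j) (D j)"
        then show "\<not> is_composition T ts (unoriented (p i))"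
          using comp[of i j ts] that p[OF that] by simp
      next
        fix j assume "j \<in> {1..k}" "j \<noteq> i"
        then show "\<not> J_pieces (p i) (D i) \<subseteq> J_pieces (p j) (D j)"
          using sub[of i j] that by blast
      qed
      then show ?thesis
        using sup_Bic[OF F] unfolding x_def F_def by simp
    qed
    have up: "J_pieces (p i) (D i) \<subseteq> x" if "i \<in> {1..k}" for i
      using sup_Bic_upper[of F T] F memF[OF that] x_def by blast
    \<comment> \<open>If no member of \<open>B\<close> contained \<open>p i\<close>, the join would
      stay inside the biclosed set without \<open>p i\<close>; a member containing
      \<open>p i\<close> lies above its set of pieces. This gives irredundance, taking a subfamily
      of \<open>F\<close> for \<open>B\<close>, as well as refinement.\<close>
    have key: "\<exists>b \<in> B. J_pieces (p i) (D i) \<subseteq> b"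
      if i: "i \<in> {1..k}" and B: "\<And>b. b \<in> B \<Longrightarrow> biclosed T b" and Bx: "\<Squnion>\<^bsub>Bic T\<^esub>B = x" for i B
    proof -
      have bx: "b \<subseteq> x" if "b \<in> B" for b
        using sup_Bic_upper[of B T] B that Bx by blast
      have "\<exists>b \<in> B. unoriented (p i) \<in> b"
      proof (rule ccontr)
        assume "\<not> (\<exists>b \<in> B. unoriented (p i) \<in> b)"
        then have "\<Squnion>\<^bsub>Bic T\<^esub>B \<subseteq> x - {unoriented (p i)}"
          using B bx by (intro sup_Bic_least[OF rem[OF i]]) blast
        then show False
          using Bx up[OF i] self_in_J_pieces[OF split_choice_path[OF sc[OF i]]] by blast
      qed
      then show ?thesis
        using J_pieces_subset_of_removable[OF sc[OF i] rem[OF i] up[OF i]] B bx by blast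
    qed
    have "irredundant_join (Bic T) F"
      unfolding irredundant_join_def
    proof (intro conjI allI impI notI)
      \<comment> \<open>By \<open>key\<close>, a proper subfamily with the same join has a member
        above an omitted set; that member belongs to another index, against condition (3).\<close>
      fix A assume A: "A \<subset> F" and eq: "\<Squnion>\<^bsub>Bic T\<^esub>A = \<Squnion>\<^bsub>Bic T\<^esub>F"
      then obtain i where i: "i \<in> {1..k}" "J_pieces (p i) (D i) \<notin> A"
        unfolding F_def by blast
      then obtain b where b: "b \<in> A" "J_pieces (p i) (D i) \<subseteq> b"
        using key[of i A] F A eq x_def by blast
      then obtain j where j: "j \<in> {1..k}" "b = J_pieces (p j) (D j)"
        using A unfolding F_def by blast
      then have "j \<noteq> i"
        using i(2) b(1) by blast
      then show False
        using sub[OF i(1) j(1)] b(2) j(2) by blast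
    qed (use F in auto)
    moreover have "F \<subseteq> JI (Bic T)"
      using sc J_pieces_in_JI unfolding F_def by blast
    moreover have "join_refines (Bic T) F B" if "B \<subseteq> JI (Bic T)" "x = \<Squnion>\<^bsub>Bic T\<^esub>B" for B
    proof -
      have "biclosed T b" if "b \<in> B" for b
        using that \<open>B \<subseteq> JI (Bic T)\<close> by (auto simp: JI_def)
      then show ?thesis
        using key[of _ B] that(2) unfolding join_refines_def le_Bic F_def by blast
    qed
    ultimately have "canonical_join_representation (Bic T) x F"
      unfolding canonical_join_representation_def x_def by blast
    then show "F \<in> canonical_join_complex (Bic T)"
      using x unfolding canonical_join_complex_def by auto
  qed
qed

end
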